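(* Suppose that $p$ is differentiable and $\log$-concave on $\mathbb{R}^d$ with $\lim_{|x|\to\infty}p(x)=0$, and that there exist $a\in[1,2]$ and $\delta>0$ such that (i) $\dfrac{|\nabla p(x)|}{p(x)}=O(|x|^{a-1})$ as $|x|\to\infty$; (ii) $x\mapsto\log p(x)+\delta|x|^a$ is convex on $\mathbb{R}^d$. Suppose that $F$ satisfies $$\forall\,\theta\in\mathbb{R}^d,\quad\mathbb{E}\left[F^2(X)\frac{p(X)}{p(X-\theta)}\right]<+\infty\qquad\text{and}\qquad\forall\,K>0,\quad\mathbb{E}\left[F^2(X)e^{K|X|^{a-1}}\right]<+\infty .$$ Suppose further that there exist real constants $c>0$, $C>0$ and a Borel function $\widetilde F:\mathbb{R}^d\to\mathbb{R}_+$ such that, for all $x,y\in\mathbb{R}^d$, $$|F(x)|\le\widetilde F(x),\qquad\widetilde F(x+y)\le C(1+\widetilde F(x))^c(1+\widetilde F(y))^c,\qquad\text{and}\qquad\mathbb{E}\left[|X|^{2(a-1)}\widetilde F(X)^{4c}\right]<+\infty .$$ Let $(\gamma_n)_{n\ge1}$ be a sequence of positive real numbers with $\sum_{n\ge1}\gamma_n=+\infty$ and $\sum_{n\ge1}\gamma_n^2<+\infty$. Define, for $\theta,x\in\mathbb{R}^d$, $$H(\theta,x):=\frac{F^2(x-\theta)}{1+\widetilde F(-\theta)^{2c}}\,e^{-2\delta|\theta|^a}\,\frac{p^2(x-\theta)}{p(x)\,p(x-2\theta)}\,\frac{\nabla p(x-2\theta)}{p(x-2\theta)} .$$ Let $(X_n)_{n\ge1}$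 be an i.i.d. sequence with the same distribution as $X$. Then the recursive procedure $$\theta_{n+1}=\theta_n-\gamma_{n+1}H(\theta_n,X_{n+1}),\quad n\ge0,\qquad\theta_0\in\mathbb{R}^d,$$ converges almost surely toward an $\operatorname{Argmin}V$-valued square integrable random variable $\theta^*$.
   Context: $X$ is an $\mathbb{R}^d$-valued random vector whose distribution has a probability density $p$ with respect to Lebesgue measure, with $p(x)>0$ for every $x\in\mathbb{R}^d$. $F:\mathbb{R}^d\to\mathbb{R}$ is a Borel function with $\mathbb{E}[F(X)^2]<+\infty$ and $\mathbb{P}(F(X)\neq0)>0$. Importance sampling is by mean translation, $p_\theta(x)=p(x-\theta)$ for $\theta\in\mathbb{R}^d$, and $$V(\theta)=\mathbb{E}\left[F^2(X)\frac{p(X)}{p(X-\theta)}\right],\qquad\theta\in\mathbb{R}^d .$$ $\operatorname{Argmin}V$ is the set of global minimizers of $V$ on $\mathbb{R}^d$. *)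

theory Defs
  imports "HOL-Probability.Probability" "HOL-Library.Landau_Symbols"
begin

definition gradient :: "('a::real_inner \<Rightarrow> real) \<Rightarrow> 'a \<Rightarrow> 'a" where
  "gradient f x = (THE D. GDERIV f x :> D)"

definition Argmin :: "('a \<Rightarrow> 'b::linorder) \<Rightarrow> 'a set" where
  "Argmin f = {x. \<forall>y. f x \<le> f y}"

(* Second moment of the importance sampling estimator under mean translation. The value lies
   in [0, \<infinity>]; for a positive density p the coercion ennreal does not truncate anything. *)
definition V_trans ::
  "'w measure \<Rightarrow> ('w \<Rightarrow> 'a) \<Rightarrow> ('a::real_normed_vector \<Rightarrow> real) \<Rightarrow> ('a \<Rightarrow> real) \<Rightarrow> 'a \<Rightarrow> ennreal" where
  "V_trans M X p F \<theta> = (\<integral>\<^sup>+ \<omega>. ennreal ((F (X \<omega>))\<^sup>2 * (p (X \<omega>) / p (X \<omega> - \<theta>))) \<partial>M)"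

(* Here 0 powr r = 0 is harmless: the exponents a and 2 * c are positive in the intended use,
   and the base Ft (- \<theta>) is nonnegative. *)
definition H_trans ::
  "('a::real_inner \<Rightarrow> real) \<Rightarrow> ('a \<Rightarrow> real) \<Rightarrow> ('a \<Rightarrow> real) \<Rightarrow> real \<Rightarrow> real \<Rightarrow> real \<Rightarrow> 'a \<Rightarrow> 'a \<Rightarrow> 'a" where
  "H_trans p F Ft a \<delta> c \<theta> x =
     ((F (x - \<theta>))\<^sup>2 / (1 + Ft (- \<theta>) powr (2 * c))
       * exp (- 2 * \<delta> * norm \<theta> powr a)
       * ((p (x - \<theta>))\<^sup>2 / (p x * p (x - 2 *\<^sub>R \<theta>))))
     *\<^sub>R ((1 / p (x - 2 *\<^sub>R \<theta>)) *\<^sub>R gradient p (x - 2 *\<^sub>R \<theta>))"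

end

theory Submission
  imports Defs
begin

text \<open>
The proof is a Lyapunov argument. By \<open>\<delta>\<close>-convexity the factor \<open>exp (- 2 \<delta> |\<theta>|\<^sup>a)\<close> dominates the
likelihood ratio in \<open>H\<close>, and the quasi-submultiplicativity of the envelope absorbs \<open>F\<^sup>2\<close>, so the
second moment of \<open>H \<theta>\<close> grows at most like \<open>1 + |\<theta>|\<^sup>2\<close>. After a translation, log-concavity shows
that the mean field \<open>h\<close> satisfies \<open>h \<theta> \<bullet> (\<theta> - s) \<ge> \<rho> \<theta> * (V \<theta> - V s)\<close> with \<open>\<rho>\<close> locally bounded
below; this replaces differentiation under the integral sign. For every minimizer \<open>s\<close>, the process
\<open>sqrt (1 + |\<theta> n - s|\<^sup>2)\<close> is decreasing up to a summable error and an \<open>L\<^sup>2\<close>-bounded martingale, hence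
converges. Doing this for a countable dense set of minimizers, and noting that divergence of
\<open>\<Sum> \<gamma> n\<close> forces \<open>V (\<theta> n)\<close> to come arbitrarily close to \<open>min V\<close>, identifies the limit by lower
semicontinuity of \<open>V\<close>.
\<close>

section \<open>Square-integrable martingale differences\<close>

text \<open>The factor \<open>\<rho> t\<close> tends to 0 at infinity, so the drift exerts no
  uniform pull on distant points. Boundedness of a path must therefore precede any use of the drift
  for locating the limit: one convergent distance to a minimizer confines the path to a ball, where
  \<open>\<rho>\<close> has a positive lower bound. A second obstacle lies in the growth bound:
  integrability is assumed for the product of a power of \<open>norm X\<close> and a power of the
  envelope, while each factor is also needed alone. This is the source of two analytic detours, the
  local boundedness of the envelope and the finite second moment of a log-concave density vanishing
  at infinity.\<close>

lemma integrable_mult_of_squares: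
  fixes f g :: "'a \<Rightarrow> real"
  assumes [measurable]: "f \<in> borel_measurable M" "g \<in> borel_measurable M"
    and "integrable M (\<lambda>x. (f x)\<^sup>2)" "integrable M (\<lambda>x. (g x)\<^sup>2)"
  shows "integrable M (\<lambda>x. f x * g x)"
proof (rule Bochner_Integration.integrable_bound)
  show "integrable M (\<lambda>x. (f x)\<^sup>2 + (g x)\<^sup>2)" using assms by auto
  show "AE x in M. norm (f x * g x) \<le> norm ((f x)\<^sup>2 + (g x)\<^sup>2)"
  proof (rule AE_I2)
    fix x
    have "2 * (\<bar>f x\<bar> * \<bar>g x\<bar>) \<le> (f x)\<^sup>2 + (g x)\<^sup>2"
      using sum_squares_bound[of "\<bar>f x\<bar>" "\<bar>g x\<bar>"] by (simp add: mult.assoc)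
    moreover have "0 \<le> \<bar>f x\<bar> * \<bar>g x\<bar>" by simp
    ultimately have "\<bar>f x\<bar> * \<bar>g x\<bar> \<le> (f x)\<^sup>2 + (g x)\<^sup>2" by linarith
    then show "norm (f x * g x) \<le> norm ((f x)\<^sup>2 + (g x)\<^sup>2)" by (simp add: abs_mult)
  qed
qed simp

lemma integrable_square_add:
  fixes f g :: "'a \<Rightarrow> real"
  assumes [measurable]: "f \<in> borel_measurable M" "g \<in> borel_measurable M"
    and "integrable M (\<lambda>x. (f x)\<^sup>2)" "integrable M (\<lambda>x. (g x)\<^sup>2)"
  shows "integrable M (\<lambda>x. (f x + g x)\<^sup>2)"
  unfolding power2_sum using assms integrable_mult_of_squares[of f M g]
  by (auto simp: mult.assoc)

text \<open>The partial sums of \<open>d\<close>, frozen as soon as their modulus reaches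
  \<open>e\<close>. The recursion lets the decision at index \<open>n\<close> depend on the past
  only, so every increment is a past-measurable indicator times \<open>d n\<close>.\<close>

fun stopped_sum :: "real \<Rightarrow> (nat \<Rightarrow> real) \<Rightarrow> nat \<Rightarrow> real" where
  "stopped_sum e d 0 = 0"
| "stopped_sum e d (Suc n) = stopped_sum e d n + (if \<bar>stopped_sum e d n\<bar> < e then d n else 0)"

text \<open>Used in contrapositive form: a partial sum of modulus at least \<open>e\<close> at some
  index up to \<open>n\<close> freezes the stopped sum there or earlier, so at \<open>n\<close> it
  still has modulus at least \<open>e\<close>.\<close>

lemma stopped_sum_eq:
  "\<bar>stopped_sum e d n\<bar> < e \<Longrightarrow> k \<le> n \<Longrightarrow> stopped_sum e d k = sum d {..<k} \<and> \<bar>sum d {..<k}\<bar> < e"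
proof (induction n arbitrary: k)
  case (Suc n)
  have lt: "\<bar>stopped_sum e d n\<bar> < e" using Suc.prems by (auto split: if_splits)
  with Suc.IH[OF lt] Suc.prems show ?case
    by (cases "k = Suc n") (auto simp: le_Suc_eq split: if_splits)
qed simp

text \<open>\<open>orthogonal\<close> is the martingale property E(D n | G n) = 0, expressed by
  testing against square-integrable \<open>G n\<close>-measurable functions. \<open>D n\<close> is
  revealed at time \<open>Suc n\<close>, hence the shifted index in \<open>adapted\<close>.\<close>

locale L2_martingale_differences = prob_space +
  fixes G :: "nat \<Rightarrow> 'a measure" and D :: "nat \<Rightarrow> 'a \<Rightarrow> real"
  assumes subalg: "\<And>n. subalgebra M (G n)"
    and mono_G: "\<And>n. sets (G n) \<subseteq> sets (G (Suc n))"
    and adapted: "\<And>n. D n \<in> borel_measurable (G (Suc n))"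
    and square_integrable: "\<And>n. integrable M (\<lambda>x. (D n x)\<^sup>2)"
    and orthogonal: "\<And>n g. g \<in> borel_measurable (G n) \<Longrightarrow> integrable M (\<lambda>x. (g x)\<^sup>2)
                      \<Longrightarrow> (\<integral>x. g x * D n x \<partial>M) = 0"
begin

lemma measurable_G_M: "f \<in> borel_measurable (G n) \<Longrightarrow> f \<in> borel_measurable M"
  using subalg measurable_from_subalg by blast

lemma measurable_G_Suc: "f \<in> borel_measurable (G n) \<Longrightarrow> f \<in> borel_measurable (G (Suc n))"
  using subalg[of n] subalg[of "Suc n"] mono_G[of n]
  by (intro measurable_from_subalg[of "G (Suc n)" "G n"]) (auto simp: subalgebra_def)

lemma D_measurable [measurable]: "D n \<in> borel_measurable M"
  using adapted measurable_G_M by blast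

lemma shifted: "L2_martingale_differences M (\<lambda>n. G (m + n)) (\<lambda>n. D (m + n))"
  using subalg mono_G adapted square_integrable orthogonal
  by unfold_locales auto

text \<open>Pythagoras: the increment is \<open>B * D n\<close> with \<open>B\<close> an indicator
  known at time \<open>n\<close>, and the cross term vanishes by \<open>orthogonal\<close> tested
  against \<open>B * T n\<close>. Measurability and square integrability run through the same
  induction because that test requires them.\<close>

lemma stopped_sum_L2:
  fixes e :: real
  defines "T \<equiv> \<lambda>n x. stopped_sum e (\<lambda>k. D k x) n"
  shows "T n \<in> borel_measurable (G n)" "integrable M (\<lambda>x. (T n x)\<^sup>2)"
    "(\<integral>x. (T n x)\<^sup>2 \<partial>M) \<le> (\<Sum>k<n. \<integral>x. (D k x)\<^sup>2 \<partial>M)"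
proof (induction n)
  case 0
  { case 1 then show ?case by (simp add: T_def) }
  { case 2 then show ?case by (simp add: T_def) }
  { case 3 then show ?case by (simp add: T_def) }
next
  case (Suc n)
  note IH = Suc.IH
  define B where "B = (\<lambda>x. indicator {x. \<bar>T n x\<bar> < e} x :: real)"
  have BG: "B \<in> borel_measurable (G n)"
  proof -
    note IH(1)[measurable]
    show ?thesis unfolding B_def by measurable
  qed
  have B01: "B x = 0 \<or> B x = 1" for x unfolding B_def by (simp add: indicator_def)
  have TS: "T (Suc n) x = T n x + B x * D n x" for x
    by (simp add: T_def B_def indicator_def)
  have [measurable]: "T n \<in> borel_measurable M" "B \<in> borel_measurable M"
    using IH(1) BG measurable_G_M by auto
  have B1: "(B x * y)\<^sup>2 \<le> y\<^sup>2" for x y using B01[of x] by auto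
  have iBD: "integrable M (\<lambda>x. (B x * D n x)\<^sup>2)"
    by (rule Bochner_Integration.integrable_bound[OF square_integrable[of n]]) (auto simp: B1)
  have iBT: "integrable M (\<lambda>x. (B x * T n x)\<^sup>2)"
    by (rule Bochner_Integration.integrable_bound[OF IH(2)]) (auto simp: B1)
  { case 1
    have [measurable]: "T n \<in> borel_measurable (G (Suc n))" "B \<in> borel_measurable (G (Suc n))"
        "D n \<in> borel_measurable (G (Suc n))"
      using IH(1) BG adapted measurable_G_Suc by auto
    show ?case unfolding TS by measurable }
  { case 2 show ?case unfolding TS using integrable_square_add[OF _ _ IH(2) iBD] by simp }
  { case 3
    have orth: "(\<integral>x. (B x * T n x) * D n x \<partial>M) = 0"
    proof (rule orthogonal)
      note IH(1)[measurable] BG[measurable]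
      show "(\<lambda>x. B x * T n x) \<in> borel_measurable (G n)" by measurable
    qed (rule iBT)
    have iTD: "integrable M (\<lambda>x. (B x * T n x) * D n x)"
      by (rule integrable_mult_of_squares[OF _ _ iBT square_integrable]) auto
    have "(\<integral>x. (T (Suc n) x)\<^sup>2 \<partial>M) = (\<integral>x. (T n x)\<^sup>2 + (B x * D n x)\<^sup>2 + 2 * ((B x * T n x) * D n x) \<partial>M)"
      unfolding TS by (simp add: power2_sum algebra_simps)
    also have "\<dots> = (\<integral>x. (T n x)\<^sup>2 \<partial>M) + (\<integral>x. (B x * D n x)\<^sup>2 \<partial>M)"
      using IH(2) iBD iTD orth by simp
    also have "(\<integral>x. (B x * D n x)\<^sup>2 \<partial>M) \<le> (\<integral>x. (D n x)\<^sup>2 \<partial>M)"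
      by (rule integral_mono[OF iBD square_integrable]) (rule B1)
    finally show ?case using IH(3) by simp }
qed

text \<open>Kolmogorov's maximal inequality. The stopped sum at the single time \<open>n\<close>
  remembers every crossing of the level \<open>e\<close> up to \<open>n\<close>, so Chebyshev's
  inequality at time \<open>n\<close> suffices.\<close>

lemma maximal_inequality:
  assumes e: "e > 0"
  shows "prob {x\<in>space M. \<exists>k\<le>n. e \<le> \<bar>\<Sum>j<k. D j x\<bar>} \<le> (\<Sum>k<n. \<integral>x. (D k x)\<^sup>2 \<partial>M) / e\<^sup>2"
proof -
  define T where "T = (\<lambda>n x. stopped_sum e (\<lambda>k. D k x) n)"
  have L2: "T n \<in> borel_measurable M" "integrable M (\<lambda>x. (T n x)\<^sup>2)"
    "(\<integral>x. (T n x)\<^sup>2 \<partial>M) \<le> (\<Sum>k<n. \<integral>x. (D k x)\<^sup>2 \<partial>M)" for n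
    using measurable_G_M[OF stopped_sum_L2(1)[where e=e and n=n]] stopped_sum_L2(2)[where e=e and n=n] stopped_sum_L2(3)[where e=e and n=n]
    unfolding T_def by auto
  note L2(1)[measurable]
  have "{x\<in>space M. \<exists>k\<le>n. e \<le> \<bar>\<Sum>j<k. D j x\<bar>} \<subseteq> {x\<in>space M. \<bar>T n x\<bar> \<ge> e}"
  proof (intro subsetI CollectI conjI; elim CollectE conjE exE)
    fix x k assume "k \<le> n" "e \<le> \<bar>\<Sum>j<k. D j x\<bar>"
    then show "e \<le> \<bar>T n x\<bar>"
      using stopped_sum_eq[of e "\<lambda>k. D k x" n k] unfolding T_def by linarith
  qed
  then have "prob {x\<in>space M. \<exists>k\<le>n. e \<le> \<bar>\<Sum>j<k. D j x\<bar>} \<le> prob {x\<in>space M. \<bar>T n x\<bar> \<ge> e}"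
    by (intro finite_measure_mono) auto
  also have "\<dots> \<le> (\<integral>x. (T n x)\<^sup>2 \<partial>M) / e\<^sup>2"
    by (rule second_moment_method[OF L2(1) L2(2) e])
  also have "\<dots> \<le> (\<Sum>k<n. \<integral>x. (D k x)\<^sup>2 \<partial>M) / e\<^sup>2"
    by (rule divide_right_mono[OF L2(3)]) simp
  finally show ?thesis .
qed

lemma maximal_inequality_infinite:
  assumes e: "e > 0" and summ: "summable (\<lambda>k. \<integral>x. (D k x)\<^sup>2 \<partial>M)"
  shows "prob {x\<in>space M. \<exists>k. e \<le> \<bar>\<Sum>j<k. D j x\<bar>} \<le> (\<Sum>k. \<integral>x. (D k x)\<^sup>2 \<partial>M) / e\<^sup>2"
proof -
  define A where "A = (\<lambda>n. {x\<in>space M. \<exists>k\<le>n. e \<le> \<bar>\<Sum>j<k. D j x\<bar>})"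
  have "(\<lambda>n. prob (A n)) \<longlonglongrightarrow> prob (\<Union>n. A n)"
  proof (rule finite_Lim_measure_incseq)
    show "range A \<subseteq> events" unfolding A_def by auto
    show "incseq A" unfolding A_def incseq_def using le_trans by blast
  qed
  moreover have "(\<Union>n. A n) = {x\<in>space M. \<exists>k. e \<le> \<bar>\<Sum>j<k. D j x\<bar>}"
    unfolding A_def by auto
  moreover have "prob (A n) \<le> (\<Sum>k. \<integral>x. (D k x)\<^sup>2 \<partial>M) / e\<^sup>2" for n
  proof -
    have "prob (A n) \<le> (\<Sum>k<n. \<integral>x. (D k x)\<^sup>2 \<partial>M) / e\<^sup>2"
      unfolding A_def by (rule maximal_inequality[OF e])
    also have "\<dots> \<le> (\<Sum>k. \<integral>x. (D k x)\<^sup>2 \<partial>M) / e\<^sup>2"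
      by (intro divide_right_mono sum_le_suminf summ) auto
    finally show ?thesis .
  qed
  ultimately show ?thesis by (auto intro: LIMSEQ_le_const2)
qed

text \<open>The maximal inequality for the sequence started at \<open>m\<close> bounds the
  probability of ever reaching level \<open>e\<close> by a tail of the variance series, which tends
  to 0. So almost surely some tail has all its partial sums below \<open>e\<close>; letting
  \<open>e\<close> run through \<open>inverse (Suc r)\<close> gives the Cauchy criterion.\<close>

theorem AE_summable:
  assumes summ: "summable (\<lambda>k. \<integral>x. (D k x)\<^sup>2 \<partial>M)"
  shows "AE x in M. summable (\<lambda>k. D k x)"
proof -
  define v where "v = (\<lambda>k. \<integral>x. (D k x)\<^sup>2 \<partial>M)"
  have small: "AE x in M. \<exists>m. \<forall>k. \<bar>\<Sum>j<k. D (m + j) x\<bar> < e" if e: "e > 0" for e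
  proof -
    define N where "N = (\<lambda>m. {x\<in>space M. \<exists>k. e \<le> \<bar>\<Sum>j<k. D (m + j) x\<bar>})"
    have N[measurable]: "N m \<in> events" for m unfolding N_def by measurable
    have le: "prob (\<Inter>m. N m) \<le> (\<Sum>k. v (k + m)) / e\<^sup>2" for m
    proof -
      interpret S: L2_martingale_differences M "\<lambda>n. G (m + n)" "\<lambda>n. D (m + n)" by (rule shifted)
      have "prob (\<Inter>m. N m) \<le> prob (N m)" by (intro finite_measure_mono) auto
      also have "\<dots> \<le> (\<Sum>k. v (m + k)) / e\<^sup>2"
        unfolding N_def v_def
        by (rule S.maximal_inequality_infinite[OF e])
          (use summable_ignore_initial_segment[OF summ, of m] in \<open>simp add: add.commute\<close>)
      finally show ?thesis by (simp add: add.commute)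
    qed
    have "(\<lambda>m. (\<Sum>k. v (k + m)) / e\<^sup>2) \<longlonglongrightarrow> 0 / e\<^sup>2"
      using suminf_exist_split2[of v] summ e by (intro tendsto_divide) (auto simp: v_def)
    then have "prob (\<Inter>m. N m) \<le> 0" using le by (intro LIMSEQ_le_const) auto
    then have "prob (\<Inter>m. N m) = 0" by (simp add: measure_le_0_iff)
    moreover have "(\<Inter>m. N m) \<in> events" by auto
    ultimately have "(\<Inter>m. N m) \<in> null_sets M" by (auto simp: null_sets_def emeasure_eq_measure)
    then show ?thesis
      by (rule AE_I') (auto simp: N_def not_less)
  qed
  have "AE x in M. \<forall>r::nat. \<exists>m. \<forall>k. \<bar>\<Sum>j<k. D (m + j) x\<bar> < inverse (Suc r)"
    by (subst AE_all_countable) (intro allI small, simp)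
  then show ?thesis
  proof eventually_elim
    case (elim x)
    show ?case unfolding summable_Cauchy
    proof (intro allI impI)
      fix e :: real assume "e > 0"
      \<comment> \<open>Half of \<open>e\<close>, because a block from \<open>i\<close> to
        \<open>n\<close> is the difference of two blocks starting at \<open>m\<close>.\<close>
      then obtain r where r: "inverse (Suc r) < e / 2" using reals_Archimedean[of "e/2"] by auto
      from elim obtain m where m: "\<And>k. \<bar>\<Sum>j<k. D (m + j) x\<bar> < inverse (Suc r)" by blast
      have sh: "(\<Sum>j<k. D (m + j) x) = sum (\<lambda>j. D j x) {m..<m+k}" for k
        by (rule sum.reindex_bij_witness[of _ "\<lambda>j. j - m" "\<lambda>j. m + j"]) auto
      show "\<exists>N. \<forall>i\<ge>N. \<forall>n. norm (sum (\<lambda>j. D j x) {i..<n}) < e"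
      proof (intro exI[of _ m] allI impI)
        fix i n assume i: "m \<le> i"
        show "norm (sum (\<lambda>j. D j x) {i..<n}) < e"
        proof (cases "i \<le> n")
          case True
          have "sum (\<lambda>j. D j x) {m..<i} + sum (\<lambda>j. D j x) {i..<n} = sum (\<lambda>j. D j x) {m..<n}"
            by (rule sum.atLeastLessThan_concat) (use i True in auto)
          moreover have "\<bar>sum (\<lambda>j. D j x) {m..<i}\<bar> < e/2"
            using m[of "i - m"] r sh[of "i-m"] i by auto
          moreover have "\<bar>sum (\<lambda>j. D j x) {m..<n}\<bar> < e/2"
            using m[of "n - m"] r sh[of "n-m"] i True by auto
          ultimately show ?thesis by (simp add: abs_if split: if_splits)
        qed (use \<open>e > 0\<close> in simp)
      qed
    qed
  qed
qed

end

section \<open>Deterministic recursions and identification of the limit\<close>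

lemma summable_of_almost_decreasing:
  fixes S v w :: "nat \<Rightarrow> real"
  assumes S: "\<And>n. 0 \<le> S n" and v: "\<And>n. 0 \<le> v n" and w: "summable w"
    and step: "\<And>n. S (Suc n) \<le> S n - v n + w n"
  shows "convergent S" "summable v"
proof -
  \<comment> \<open>Compensating \<open>S\<close> by both partial sums gives a decreasing sequence
    that is bounded below. No sign is imposed on \<open>w\<close>, whose series merely converges;
    this is what later allows martingale increments to be part of it.\<close>
  define R where "R = (\<lambda>n. S n + sum v {..<n} - sum w {..<n})"
  have "decseq R" unfolding decseq_Suc_iff R_def using step by (simp add: algebra_simps)
  then have R0: "R n \<le> R 0" for n by (simp add: decseqD)
  have "convergent (\<lambda>n. sum w {..<n})" using w summable_iff_convergent by blast
  then obtain B where B: "\<And>n. norm (sum w {..<n}) \<le> B"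
    using convergent_imp_Bseq BseqE by metis
  have "sum v {..<n} \<le> R 0 + B" for n
    using R0[of n] B[of n] S[of n] unfolding R_def by (auto simp: abs_le_iff)
  then show sv: "summable v" using v by (intro summableI_nonneg_bounded)
  have "R n \<ge> - B" for n
    using B[of n] S[of n] sum_nonneg[of "{..<n}" v] v unfolding R_def by (simp add: abs_le_iff)
  then obtain l where "R \<longlonglongrightarrow> l" using decseq_convergent[OF \<open>decseq R\<close>] by blast
  then have "(\<lambda>n. R n - sum v {..<n} + sum w {..<n}) \<longlonglongrightarrow> l - suminf v + suminf w"
    using summable_LIMSEQ[OF sv] summable_LIMSEQ[OF w] by (intro tendsto_intros)
  then show "convergent S" unfolding R_def convergent_def by auto
qed

text \<open>A discrete Gronwall inequality, from \<open>1 + b n \<le> exp (b n)\<close>.\<close>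

lemma bounded_multiplicative_recursion:
  fixes a b :: "nat \<Rightarrow> real"
  assumes a: "\<And>n. 0 \<le> a n" and b: "\<And>n. 0 \<le> b n" "summable b"
    and step: "\<And>n. a (Suc n) \<le> a n * (1 + b n)"
  shows "a n \<le> a 0 * exp (suminf b)"
proof -
  have "a n \<le> a 0 * exp (sum b {..<n})"
  proof (induction n)
    case (Suc n)
    have "a (Suc n) \<le> a n * exp (b n)"
      using step[of n] mult_left_mono[OF exp_ge_add_one_self[of "b n"] a[of n]] by linarith
    also have "\<dots> \<le> (a 0 * exp (sum b {..<n})) * exp (b n)"
      using Suc by (intro mult_right_mono) auto
    finally show ?case by (simp add: exp_add mult.assoc)
  qed simp
  also have "\<dots> \<le> a 0 * exp (suminf b)"
    using a[of 0] b by (intro mult_left_mono) (auto intro: sum_le_suminf)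
  finally show ?thesis .
qed

text \<open>Concavity of the square root, read off from a square being nonnegative. It turns the
  exact expansion of the squared distance into a one-step inequality for the Lyapunov
  function.\<close>

lemma sqrt_le_tangent:
  assumes "a > 0" "b \<ge> 0"
  shows "sqrt b \<le> sqrt a + (b - a) / (2 * sqrt a)"
proof -
  have "0 \<le> (sqrt b - sqrt a)\<^sup>2" by simp
  then have "2 * sqrt a * sqrt b \<le> a + b" using assms by (simp add: power2_diff algebra_simps)
  moreover have "(sqrt b - sqrt a) * (2 * sqrt a) = 2 * sqrt a * sqrt b - 2 * (sqrt a * sqrt a)"
    by (simp only: algebra_simps)
  moreover have "sqrt a * sqrt a = a" using assms by simp
  ultimately have "(sqrt b - sqrt a) * (2 * sqrt a) \<le> b - a" by linarith
  then have "sqrt b - sqrt a \<le> (b - a) / (2 * sqrt a)" using assms by (simp add: pos_le_divide_eq)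
  then show ?thesis by simp
qed

text \<open>Opial's argument: the distances to all points of \<open>A\<close> converge, so a cluster point in \<open>A\<close>
  is the limit.\<close>
lemma convergent_to_minimizer:
  fixes x :: "nat \<Rightarrow> 'v::euclidean_space" and L :: "'v \<Rightarrow> real"
  assumes D: "D \<subseteq> Argmin L" "Argmin L \<subseteq> closure D" and s0: "s0 \<in> D"
    and dist: "\<And>s. s \<in> D \<Longrightarrow> convergent (\<lambda>n. norm (x n - s))"
    and lsc: "\<And>u t l. u \<longlonglongrightarrow> t \<Longrightarrow> (\<lambda>n. L (u n)) \<longlonglongrightarrow> l \<Longrightarrow> L t \<le> l"
    and g: "\<And>n. 0 < g n" "\<not> summable g"
    and rho: "\<And>R. \<exists>r>0. \<forall>t. norm t \<le> R \<longrightarrow> r \<le> \<rho> t"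
    and summ: "summable (\<lambda>n. g n * (\<rho> (x n) * (L (x n) - L s0)))"
  shows "\<exists>t\<in>Argmin L. x \<longlonglongrightarrow> t"
proof -
  have min: "L s0 \<le> L y" for y using s0 D unfolding Argmin_def by auto
  obtain B where "\<And>n. norm (norm (x n - s0)) \<le> B"
    using convergent_imp_Bseq[OF dist[OF s0]] BseqE by metis
  then have B: "norm (x n) \<le> B + norm s0" for n
    using norm_triangle_ineq[of "x n - s0" s0] by (simp add: add_increasing order_trans)
  obtain r where r: "r > 0" "\<And>n. r \<le> \<rho> (x n)" using rho[of "B + norm s0"] B by auto
  \<comment> \<open>Along the path, which stays in a ball, \<open>\<rho>\<close> is at least
    \<open>r\<close>. A gap of at least \<open>1 / Suc k\<close> from index \<open>k\<close> on
    would then make \<open>g\<close> summable by comparison.\<close>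
  have ex: "\<exists>n\<ge>k. L (x n) < L s0 + 1 / Suc k" for k
  proof (rule ccontr)
    assume neg: "\<not> ?thesis"
    have "summable g"
    proof (rule summable_comparison_test_ev)
      show "summable (\<lambda>n. (Suc k / r) * (g n * (\<rho> (x n) * (L (x n) - L s0))))"
        using summ by (rule summable_mult)
      have "norm (g n) \<le> (Suc k / r) * (g n * (\<rho> (x n) * (L (x n) - L s0)))" if "n \<ge> k" for n
      proof -
        have "1 / Suc k \<le> L (x n) - L s0" using neg that by (auto simp: not_less)
        then have "r * (1 / Suc k) \<le> \<rho> (x n) * (L (x n) - L s0)"
          using r by (intro mult_mono) (auto intro: less_imp_le order_trans[of 0 r])
        then have "g n * (r * (1 / Suc k)) \<le> g n * (\<rho> (x n) * (L (x n) - L s0))"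
          using g(1)[of n] by (intro mult_left_mono) auto
        then have "(Suc k / r) * (g n * (r * (1 / Suc k))) \<le> (Suc k / r) * (g n * (\<rho> (x n) * (L (x n) - L s0)))"
          by (rule mult_left_mono) (use r(1) in auto)
        moreover have "(Suc k / r) * (g n * (r * (1 / Suc k))) = g n"
          using r(1) by (simp add: field_simps del: of_nat_Suc)
        ultimately show ?thesis using g(1)[of n] by simp
      qed
      then show "\<forall>\<^sub>F n in sequentially. norm (g n) \<le> (Suc k / r) * (g n * (\<rho> (x n) * (L (x n) - L s0)))"
        by (auto simp: eventually_sequentially)
    qed
    with g(2) show False by simp
  qed
  obtain N where N: "\<And>k. N k \<ge> k" "\<And>k. L (x (N k)) < L s0 + 1 / Suc k" using ex by metis
  have "\<forall>k. x (N k) \<in> cball 0 (B + norm s0)" using B by auto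
  then obtain t \<sigma> where \<sigma>: "strict_mono \<sigma>" and t: "(\<lambda>j. x (N (\<sigma> j))) \<longlonglongrightarrow> t"
    using seq_compactE[OF compact_cball[of 0 "B + norm s0", unfolded compact_eq_seq_compact_metric], of "\<lambda>k. x (N k)"]
    unfolding o_def by metis
  have N\<sigma>: "filterlim (\<lambda>j. N (\<sigma> j)) sequentially sequentially"
    by (rule filterlim_at_top_mono[OF filterlim_ident always_eventually])
      (intro allI order_trans[OF seq_suble[OF \<sigma>] N(1)])
  have "(\<lambda>k. L s0 + 1 / Suc k) \<longlonglongrightarrow> L s0 + 0"
    by (intro tendsto_add tendsto_const) (use LIMSEQ_inverse_real_of_nat in \<open>simp add: inverse_eq_divide\<close>)
  then have "(\<lambda>k. L s0 + 1 / Suc k) \<longlonglongrightarrow> L s0" by simp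
  then have "(\<lambda>k. L (x (N k))) \<longlonglongrightarrow> L s0"
    by (rule tendsto_sandwich[rotated 3, where f="\<lambda>_. L s0"])
      (intro always_eventually allI min less_imp_le[OF N(2)] tendsto_const)+
  from LIMSEQ_subseq_LIMSEQ[OF this \<sigma>] have "(\<lambda>j. L (x (N (\<sigma> j)))) \<longlonglongrightarrow> L s0" by (simp add: o_def)
  from lsc[OF t this] have tA: "t \<in> Argmin L" using order_trans[OF _ min] unfolding Argmin_def by blast
  have "x \<longlonglongrightarrow> t"
  proof (rule LIMSEQ_I)
    fix e :: real assume e: "e > 0"
    obtain d where d: "d \<in> D" "norm (d - t) < e / 3"
      using D(2) tA e closure_approachable[of t D] unfolding dist_norm
      by (metis divide_pos_pos subsetD zero_less_numeral)
    obtain l where l: "(\<lambda>n. norm (x n - d)) \<longlonglongrightarrow> l" using dist[OF d(1)] unfolding convergent_def by blast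
    \<comment> \<open>\<open>t\<close> may lie outside \<open>D\<close>, so its distance to the path
      is estimated through \<open>d\<close>: the whole sequence of distances to \<open>d\<close>
      converges, and the subsequence identifies the limit as \<open>norm (t - d)\<close>.\<close>
    have "(\<lambda>j. norm (x (N (\<sigma> j)) - d)) \<longlonglongrightarrow> norm (t - d)" using t by (intro tendsto_intros)
    moreover have "(\<lambda>j. norm (x (N (\<sigma> j)) - d)) \<longlonglongrightarrow> l" using filterlim_compose[OF l N\<sigma>] .
    ultimately have "l = norm (t - d)" by (metis LIMSEQ_unique)
    then have "l < 2 * e / 3" using d(2) e by (simp add: norm_minus_commute)
    then have "\<forall>\<^sub>F n in sequentially. norm (x n - d) < 2 * e / 3" using order_tendstoD(2)[OF l] by blast
    then obtain n0 where n0: "\<And>n. n \<ge> n0 \<Longrightarrow> norm (x n - d) < 2 * e / 3" by (auto simp: eventually_sequentially)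
    have "norm (x n - t) < e" if "n \<ge> n0" for n
      using norm_triangle_ineq[of "x n - d" "d - t"] n0[OF that] d(2) by simp
    then show "\<exists>n0. \<forall>n\<ge>n0. norm (x n - t) < e" by blast
  qed
  with tA show ?thesis by blast
qed

section \<open>Stochastic approximation\<close>

locale stochastic_approximation = prob_space +
  fixes N :: "'b measure" and \<mu> :: "'b measure" and H :: "'v::euclidean_space \<Rightarrow> 'b \<Rightarrow> 'v"
    and \<gamma> :: "nat \<Rightarrow> real" and Xs :: "nat \<Rightarrow> 'a \<Rightarrow> 'b" and \<theta> :: "nat \<Rightarrow> 'a \<Rightarrow> 'v"
    and t0 :: 'v and K :: real
  assumes indep: "indep_vars (\<lambda>_. N) Xs {1..}"
    and distr_Xs: "\<And>n. 1 \<le> n \<Longrightarrow> distr M N (Xs n) = \<mu>"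
    and H_measurable: "(\<lambda>z. H (fst z) (snd z)) \<in> borel_measurable (borel \<Otimes>\<^sub>M N)"
    and H_square_integrable: "\<And>t. integrable \<mu> (\<lambda>x. (norm (H t x))\<^sup>2)"
    and H_growth: "\<And>t. (\<integral>x. (norm (H t x))\<^sup>2 \<partial>\<mu>) \<le> K * (1 + (norm t)\<^sup>2)"
    and gamma_pos: "\<And>n. 1 \<le> n \<Longrightarrow> 0 < \<gamma> n"
    and gamma_square: "summable (\<lambda>n. (\<gamma> (Suc n))\<^sup>2)"
    and theta_0: "\<And>\<omega>. \<omega> \<in> space M \<Longrightarrow> \<theta> 0 \<omega> = t0"
    and theta_Suc: "\<And>n \<omega>. \<omega> \<in> space M \<Longrightarrow>
          \<theta> (Suc n) \<omega> = \<theta> n \<omega> - \<gamma> (Suc n) *\<^sub>R H (\<theta> n \<omega>) (Xs (Suc n) \<omega>)"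
begin

section \<open>The past of the recursion and freezing of past variables\<close>

definition h :: "'v \<Rightarrow> 'v" where "h t = (\<integral>x. H t x \<partial>\<mu>)"

definition past :: "nat \<Rightarrow> 'a \<Rightarrow> nat \<Rightarrow> 'b" where "past n \<omega> = (\<lambda>i\<in>{1..n}. Xs i \<omega>)"

text \<open>The sigma-algebra generated by \<open>Xs 1\<close>, ..., \<open>Xs n\<close>, as a
  pullback under the vector \<open>past n\<close>. Its sets are literally preimages, the form in
  which independence of disjoint index blocks applies. \<open>G 0\<close> is trivial because its
  index set is empty.\<close>

definition G :: "nat \<Rightarrow> 'a measure" where
  "G n = vimage_algebra (space M) (past n) (PiM {1..n} (\<lambda>_. N))"

lemma K_nonneg: "0 \<le> K"
proof -
  have "0 \<le> (\<integral>x. (norm (H 0 x))\<^sup>2 \<partial>\<mu>)" by simp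
  also have "\<dots> \<le> K" using H_growth[of 0] by simp
  finally show ?thesis .
qed

lemma Xs_measurable: "1 \<le> n \<Longrightarrow> Xs n \<in> measurable M N"
  using indep unfolding indep_vars_def by auto

lemma Xs_Suc_measurable [measurable]: "Xs (Suc n) \<in> measurable M N"
  by (rule Xs_measurable) simp

lemma prob_space_mu: "prob_space \<mu>"
  using prob_space_distr[OF Xs_measurable[of 1]] distr_Xs[of 1] by simp

lemma sets_mu [measurable_cong, simp]: "sets \<mu> = sets N"
  using distr_Xs[of 1] sets_distr[of M N "Xs 1"] by simp

lemma space_mu [simp]: "space \<mu> = space N"
  using distr_Xs[of 1] space_distr[of M N "Xs 1"] by simp

lemma space_G [simp]: "space (G n) = space M"
  unfolding G_def by simp

lemma past_measurable [measurable]: "past n \<in> measurable M (PiM {1..n} (\<lambda>_. N))"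
  unfolding past_def by (rule measurable_restrict) (rule Xs_measurable, simp)

lemma past_in: "past n \<in> space M \<rightarrow> space (PiM {1..n} (\<lambda>_. N))"
  using measurable_space[OF past_measurable] by auto

lemma past_G: "past n \<in> measurable (G n) (PiM {1..n} (\<lambda>_. N))"
  unfolding G_def by (rule measurable_vimage_algebra1[OF past_in])

lemma sets_G: "sets (G n) = {past n -` A \<inter> space M | A. A \<in> sets (PiM {1..n} (\<lambda>_. N))}"
  unfolding G_def by (rule sets_vimage_algebra2[OF past_in])

lemma Xs_G:
  assumes "1 \<le> k" "k \<le> n" shows "Xs k \<in> measurable (G n) N"
proof -
  have "(\<lambda>\<omega>. past n \<omega> k) \<in> measurable (G n) N"
    by (rule measurable_compose[OF past_G measurable_component_singleton]) (use assms in auto)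
  then show ?thesis using assms by (simp add: past_def)
qed

lemma sets_G_subset: "sets (G n) \<subseteq> sets M"
  unfolding sets_G using measurable_sets[OF past_measurable] by auto

lemma subalgebra_G: "subalgebra M (G n)"
  unfolding subalgebra_def using sets_G_subset by simp

lemma G_mono: "sets (G n) \<subseteq> sets (G (Suc n))"
proof -
  have "past n \<in> measurable (G (Suc n)) (PiM {1..n} (\<lambda>_. N))"
    unfolding past_def by (rule measurable_restrict) (rule Xs_G, auto)
  from measurable_sets[OF this] show ?thesis unfolding sets_G[of n] by auto
qed

lemma measurable_G_M: "f \<in> measurable (G n) S \<Longrightarrow> f \<in> measurable M S"
  by (rule measurable_from_subalg[OF subalgebra_G])

lemma measurable_G_Suc: "f \<in> measurable (G n) S \<Longrightarrow> f \<in> measurable (G (Suc n)) S"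
  by (rule measurable_from_subalg[of "G (Suc n)" "G n"]) (auto simp: subalgebra_def G_mono)

lemma H_compose:
  assumes "Z \<in> borel_measurable A" "X \<in> measurable A N"
  shows "(\<lambda>\<omega>. H (Z \<omega>) (X \<omega>)) \<in> borel_measurable A"
  using measurable_compose[OF measurable_Pair[OF assms] H_measurable] by simp

lemma theta_G: "\<theta> n \<in> borel_measurable (G n)"
proof (induction n)
  case 0
  have "\<theta> 0 \<in> borel_measurable (G 0) \<longleftrightarrow> (\<lambda>_. t0) \<in> borel_measurable (G 0)"
    by (rule measurable_cong) (simp add: theta_0)
  then show ?case by simp
next
  case (Suc n)
  have [measurable]: "\<theta> n \<in> borel_measurable (G (Suc n))" using Suc by (rule measurable_G_Suc)
  have [measurable]: "(\<lambda>\<omega>. H (\<theta> n \<omega>) (Xs (Suc n) \<omega>)) \<in> borel_measurable (G (Suc n))"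
    by (rule H_compose) (auto intro: Xs_G)
  have "\<theta> (Suc n) \<in> borel_measurable (G (Suc n)) \<longleftrightarrow>
    (\<lambda>\<omega>. \<theta> n \<omega> - \<gamma> (Suc n) *\<^sub>R H (\<theta> n \<omega>) (Xs (Suc n) \<omega>)) \<in> borel_measurable (G (Suc n))"
    by (rule measurable_cong) (simp add: theta_Suc)
  then show ?case by simp
qed

lemma theta_measurable [measurable]: "\<theta> n \<in> borel_measurable M"
  using theta_G measurable_G_M by blast

lemma H_theta_measurable [measurable]: "(\<lambda>\<omega>. H (\<theta> n \<omega>) (Xs (Suc n) \<omega>)) \<in> borel_measurable M"
  by (rule H_compose) auto

lemma H_measurable_2: "H t \<in> borel_measurable \<mu>"
  using H_compose[of "\<lambda>_. t" \<mu> "\<lambda>x. x"] by simp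

text \<open>The blocks \<open>{1..n}\<close> and \<open>{Suc n}\<close> are disjoint. The single
  variable \<open>Xs (Suc n)\<close> is wrapped as a family over one index to give it the shape of a
  block.\<close>

lemma past_indep:
  assumes A: "A \<in> sets (G n)" and B: "B \<in> sets N"
  shows "prob (A \<inter> (Xs (Suc n) -` B \<inter> space M)) = prob A * prob (Xs (Suc n) -` B \<inter> space M)"
proof -
  let ?P = "\<lambda>I. PiM I (\<lambda>_. N)"
  let ?Y = "\<lambda>\<omega>. \<lambda>i\<in>{Suc n}. Xs i \<omega>"
  let ?B = "(\<lambda>f. f (Suc n)) -` B \<inter> space (?P {Suc n})"
  have ind: "indep_var (?P {1..n}) (past n) (?P {Suc n}) ?Y"
    unfolding past_def by (rule indep_var_restrict[OF indep]) auto
  obtain A' where A': "A = past n -` A' \<inter> space M" "A' \<in> sets (?P {1..n})" using A unfolding sets_G by auto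
  have B': "?B \<in> sets (?P {Suc n})"
    using measurable_sets[OF measurable_component_singleton[of "Suc n" "{Suc n}" "\<lambda>_. N"] B] by simp
  have "?Y \<in> measurable M (?P {Suc n})" by (rule measurable_restrict) auto
  from measurable_space[OF this] have Y: "?Y -` ?B \<inter> space M = Xs (Suc n) -` B \<inter> space M"
    by auto
  have "(\<lambda>x. (past n x, ?Y x)) -` (A' \<times> ?B) \<inter> space M = A \<inter> (?Y -` ?B \<inter> space M)"
    unfolding A' by auto
  then show ?thesis using indep_varD[OF ind A'(2) B'] unfolding Y A'(1)[symmetric] by simp
qed

text \<open>Independence as an identity of laws. Rectangles determine the product measure, and on a
  rectangle the claim is \<open>past_indep\<close> for the preimage of \<open>A\<close> under
  \<open>Z\<close>.\<close>

lemma joint_distr: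
  assumes Z: "Z \<in> measurable (G n) S"
  shows "distr M (S \<Otimes>\<^sub>M N) (\<lambda>\<omega>. (Z \<omega>, Xs (Suc n) \<omega>)) = distr M S Z \<Otimes>\<^sub>M \<mu>"
proof (rule sym, rule pair_measure_eqI)
  have ZM[measurable]: "Z \<in> measurable M S" using Z by (rule measurable_G_M)
  interpret mu: prob_space \<mu> by (rule prob_space_mu)
  interpret dZ: prob_space "distr M S Z" by (rule prob_space_distr) simp
  show "sigma_finite_measure (distr M S Z)" "sigma_finite_measure \<mu>" by unfold_locales
  show "sets (distr M S Z \<Otimes>\<^sub>M \<mu>) = sets (distr M (S \<Otimes>\<^sub>M N) (\<lambda>\<omega>. (Z \<omega>, Xs (Suc n) \<omega>)))"
    by simp
  fix A B assume "A \<in> sets (distr M S Z)" "B \<in> sets \<mu>"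
  then have A: "A \<in> sets S" and B: "B \<in> sets N" by auto
  have ZA: "Z -` A \<inter> space M \<in> sets (G n)" using measurable_sets[OF Z A] by simp
  have mu: "emeasure \<mu> B = emeasure M (Xs (Suc n) -` B \<inter> space M)"
    unfolding distr_Xs[of "Suc n", symmetric, simplified] using B by (rule emeasure_distr[OF Xs_Suc_measurable])
  have "emeasure (distr M (S \<Otimes>\<^sub>M N) (\<lambda>\<omega>. (Z \<omega>, Xs (Suc n) \<omega>))) (A \<times> B)
      = emeasure M ((\<lambda>\<omega>. (Z \<omega>, Xs (Suc n) \<omega>)) -` (A \<times> B) \<inter> space M)"
    using A B by (intro emeasure_distr) auto
  also have "(\<lambda>\<omega>. (Z \<omega>, Xs (Suc n) \<omega>)) -` (A \<times> B) \<inter> space M = (Z -` A \<inter> space M) \<inter> (Xs (Suc n) -` B \<inter> space M)"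
    by auto
  also have "emeasure M \<dots> = emeasure M (Z -` A \<inter> space M) * emeasure M (Xs (Suc n) -` B \<inter> space M)"
    using past_indep[OF ZA B] by (simp add: emeasure_eq_measure measure_nonneg ennreal_mult)
  also have "\<dots> = emeasure (distr M S Z) A * emeasure \<mu> B"
    using A by (simp add: mu emeasure_distr)
  finally show "emeasure (distr M S Z) A * emeasure \<mu> B
    = emeasure (distr M (S \<Otimes>\<^sub>M N) (\<lambda>\<omega>. (Z \<omega>, Xs (Suc n) \<omega>))) (A \<times> B)" by simp
qed

text \<open>The substitute for conditioning on the past: under the product law, Fubini integrates
  out \<open>Xs (Suc n)\<close> while \<open>Z\<close> stays fixed. \<open>Z\<close> takes values in
  an arbitrary space, so that several past quantities can be frozen together.\<close>

lemma freezing: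
  fixes \<phi> :: "'c \<Rightarrow> 'b \<Rightarrow> real"
  assumes Z: "Z \<in> measurable (G n) S"
    and m: "(\<lambda>z. \<phi> (fst z) (snd z)) \<in> borel_measurable (S \<Otimes>\<^sub>M N)"
    and i: "integrable M (\<lambda>\<omega>. \<phi> (Z \<omega>) (Xs (Suc n) \<omega>))"
  shows "integrable M (\<lambda>\<omega>. \<integral>x. \<phi> (Z \<omega>) x \<partial>\<mu>)"
    and "(\<integral>\<omega>. \<phi> (Z \<omega>) (Xs (Suc n) \<omega>) \<partial>M) = (\<integral>\<omega>. (\<integral>x. \<phi> (Z \<omega>) x \<partial>\<mu>) \<partial>M)"
proof -
  have [measurable]: "Z \<in> measurable M S" using Z by (rule measurable_G_M)
  interpret mu: prob_space \<mu> by (rule prob_space_mu)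
  interpret dZ: prob_space "distr M S Z" by (rule prob_space_distr) simp
  interpret P: pair_prob_space "distr M S Z" \<mu> ..
  let ?J = "distr M (S \<Otimes>\<^sub>M N) (\<lambda>\<omega>. (Z \<omega>, Xs (Suc n) \<omega>))"
  have J: "?J = distr M S Z \<Otimes>\<^sub>M \<mu>" by (rule joint_distr[OF Z])
  have pm: "(\<lambda>\<omega>. (Z \<omega>, Xs (Suc n) \<omega>)) \<in> measurable M (S \<Otimes>\<^sub>M N)" by simp
  have "integrable ?J (\<lambda>z. \<phi> (fst z) (snd z))"
    using i by (subst integrable_distr_eq[OF pm m]) simp
  then have iJ: "integrable (distr M S Z \<Otimes>\<^sub>M \<mu>) (\<lambda>(z, x). \<phi> z x)" unfolding J by (simp add: case_prod_unfold)
  note f1 = P.integrable_fst[OF iJ]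
  have mZ: "(\<lambda>z. \<integral>x. \<phi> z x \<partial>\<mu>) \<in> borel_measurable S"
    using borel_measurable_integrable[OF f1] by simp
  show "integrable M (\<lambda>\<omega>. \<integral>x. \<phi> (Z \<omega>) x \<partial>\<mu>)"
    using f1 by (subst (asm) integrable_distr_eq) (use mZ in auto)
  have "(\<integral>\<omega>. \<phi> (Z \<omega>) (Xs (Suc n) \<omega>) \<partial>M) = (\<integral>z. \<phi> (fst z) (snd z) \<partial>?J)"
    by (subst integral_distr[OF pm m]) simp
  also have "\<dots> = (\<integral>z. (\<integral>x. \<phi> z x \<partial>\<mu>) \<partial>distr M S Z)"
    unfolding J using P.integral_fst[OF iJ] by (simp add: case_prod_unfold)
  also have "\<dots> = (\<integral>\<omega>. (\<integral>x. \<phi> (Z \<omega>) x \<partial>\<mu>) \<partial>M)"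
    by (rule integral_distr) (use mZ in auto)
  finally show "(\<integral>\<omega>. \<phi> (Z \<omega>) (Xs (Suc n) \<omega>) \<partial>M) = (\<integral>\<omega>. (\<integral>x. \<phi> (Z \<omega>) x \<partial>\<mu>) \<partial>M)" .
qed

text \<open>The Tonelli counterpart; it yields the finiteness that \<open>freezing\<close> has to
  assume.\<close>

lemma nn_freezing:
  assumes Z: "Z \<in> measurable (G n) S"
    and m: "(\<lambda>z. \<phi> (fst z) (snd z)) \<in> borel_measurable (S \<Otimes>\<^sub>M N)"
  shows "(\<integral>\<^sup>+\<omega>. \<phi> (Z \<omega>) (Xs (Suc n) \<omega>) \<partial>M) = (\<integral>\<^sup>+\<omega>. (\<integral>\<^sup>+x. \<phi> (Z \<omega>) x \<partial>\<mu>) \<partial>M)"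
proof -
  have [measurable]: "Z \<in> measurable M S" using Z by (rule measurable_G_M)
  interpret mu: prob_space \<mu> by (rule prob_space_mu)
  let ?J = "distr M (S \<Otimes>\<^sub>M N) (\<lambda>\<omega>. (Z \<omega>, Xs (Suc n) \<omega>))"
  have J: "?J = distr M S Z \<Otimes>\<^sub>M \<mu>" by (rule joint_distr[OF Z])
  have pm: "(\<lambda>\<omega>. (Z \<omega>, Xs (Suc n) \<omega>)) \<in> measurable M (S \<Otimes>\<^sub>M N)" by simp
  have m': "(\<lambda>z. \<phi> (fst z) (snd z)) \<in> borel_measurable (S \<Otimes>\<^sub>M \<mu>)" using m by simp
  have mZ: "(\<lambda>z. \<integral>\<^sup>+x. \<phi> z x \<partial>\<mu>) \<in> borel_measurable S"
    using mu.borel_measurable_nn_integral_fst[OF m'] by simp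
  have "(\<integral>\<^sup>+\<omega>. \<phi> (Z \<omega>) (Xs (Suc n) \<omega>) \<partial>M) = (\<integral>\<^sup>+z. \<phi> (fst z) (snd z) \<partial>?J)"
    by (subst nn_integral_distr[OF pm]) (use m in auto)
  also have "\<dots> = (\<integral>\<^sup>+z. (\<integral>\<^sup>+x. \<phi> z x \<partial>\<mu>) \<partial>distr M S Z)"
    unfolding J by (subst mu.nn_integral_fst[symmetric]) (use m in auto)
  also have "\<dots> = (\<integral>\<^sup>+\<omega>. (\<integral>\<^sup>+x. \<phi> (Z \<omega>) x \<partial>\<mu>) \<partial>M)"
    by (rule nn_integral_distr) (use mZ in auto)
  finally show ?thesis .
qed

end

lemma norm_diff_square_le:
  fixes x y :: "'v::real_inner"
  shows "(norm (x - y))\<^sup>2 \<le> 2 * (norm x)\<^sup>2 + 2 * (norm y)\<^sup>2"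
proof -
  have "0 \<le> (norm (x + y))\<^sup>2" by simp
  then show ?thesis unfolding power2_norm_eq_inner by (simp add: inner_simps inner_commute)
qed

context stochastic_approximation
begin

section \<open>Second moments of the recursion and its martingale part\<close>

lemma H_integrable: "integrable \<mu> (H t)"
proof -
  interpret mu: prob_space \<mu> by (rule prob_space_mu)
  have "integrable \<mu> (\<lambda>x. norm (H t x))"
    by (rule mu.square_integrable_imp_integrable[OF _ H_square_integrable])
      (rule measurable_compose[OF H_measurable_2 borel_measurable_norm])
  then show ?thesis using H_measurable_2 by (simp add: integrable_norm_iff)
qed

lemma h_measurable [measurable]: "h \<in> borel_measurable borel"
proof -
  interpret mu: prob_space \<mu> by (rule prob_space_mu)
  have "(\<lambda>t. \<integral>x. H t x \<partial>\<mu>) \<in> borel_measurable borel"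
    using H_measurable by (intro mu.borel_measurable_lebesgue_integral) (simp add: case_prod_unfold)
  then show ?thesis unfolding h_def .
qed

text \<open>Jensen's inequality, here as nonnegativity of the variance of
  \<open>norm (H t x)\<close>.\<close>

lemma h_growth: "(norm (h t))\<^sup>2 \<le> K * (1 + (norm t)\<^sup>2)"
proof -
  interpret mu: prob_space \<mu> by (rule prob_space_mu)
  have i: "integrable \<mu> (\<lambda>x. norm (H t x))" using H_integrable by simp
  have "norm (h t) \<le> (\<integral>x. norm (H t x) \<partial>\<mu>)" unfolding h_def by (rule integral_norm_bound)
  then have "(norm (h t))\<^sup>2 \<le> (\<integral>x. norm (H t x) \<partial>\<mu>)\<^sup>2" by (intro power_mono) auto
  also have "\<dots> \<le> (\<integral>x. (norm (H t x))\<^sup>2 \<partial>\<mu>)"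
    using mu.variance_positive[of "\<lambda>x. norm (H t x)"] mu.variance_eq[OF i H_square_integrable] by simp
  also have "\<dots> \<le> K * (1 + (norm t)\<^sup>2)" by (rule H_growth)
  finally show ?thesis .
qed

lemma H_theta_square:
  assumes i: "integrable M (\<lambda>\<omega>. (norm (\<theta> n \<omega>))\<^sup>2)"
  shows "integrable M (\<lambda>\<omega>. (norm (H (\<theta> n \<omega>) (Xs (Suc n) \<omega>)))\<^sup>2)"
    and "(\<integral>\<omega>. (norm (H (\<theta> n \<omega>) (Xs (Suc n) \<omega>)))\<^sup>2 \<partial>M) \<le> K * (1 + (\<integral>\<omega>. (norm (\<theta> n \<omega>))\<^sup>2 \<partial>M))"
proof -
  have iK: "integrable M (\<lambda>\<omega>. K * (1 + (norm (\<theta> n \<omega>))\<^sup>2))" using i by simp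
  have m1: "(\<lambda>z. (norm (H (fst z) (snd z)))\<^sup>2) \<in> borel_measurable (borel \<Otimes>\<^sub>M N)"
    using H_measurable by measurable
  have "(\<integral>\<^sup>+\<omega>. ennreal ((norm (H (\<theta> n \<omega>) (Xs (Suc n) \<omega>)))\<^sup>2) \<partial>M)
    = (\<integral>\<^sup>+\<omega>. (\<integral>\<^sup>+x. ennreal ((norm (H (\<theta> n \<omega>) x))\<^sup>2) \<partial>\<mu>) \<partial>M)"
    by (rule nn_freezing[OF theta_G, where \<phi>="\<lambda>t x. ennreal ((norm (H t x))\<^sup>2)"]) (use m1 in simp)
  also have "\<dots> \<le> (\<integral>\<^sup>+\<omega>. ennreal (K * (1 + (norm (\<theta> n \<omega>))\<^sup>2)) \<partial>M)"
    by (intro nn_integral_mono) (simp add: nn_integral_eq_integral[OF H_square_integrable] ennreal_leI H_growth)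
  also have "\<dots> < \<infinity>"
    using iK K_nonneg by (subst nn_integral_eq_integral) auto
  finally show i2: "integrable M (\<lambda>\<omega>. (norm (H (\<theta> n \<omega>) (Xs (Suc n) \<omega>)))\<^sup>2)"
    by (intro integrableI_bounded) auto
  note fr = freezing[OF theta_G, where \<phi>="\<lambda>t x. (norm (H t x))\<^sup>2", OF m1 i2]
  have "(\<integral>\<omega>. (norm (H (\<theta> n \<omega>) (Xs (Suc n) \<omega>)))\<^sup>2 \<partial>M) \<le> (\<integral>\<omega>. K * (1 + (norm (\<theta> n \<omega>))\<^sup>2) \<partial>M)"
    unfolding fr(2) by (rule integral_mono[OF fr(1) iK H_growth])
  also have "\<dots> = K * (1 + (\<integral>\<omega>. (norm (\<theta> n \<omega>))\<^sup>2 \<partial>M))"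
    using i by (simp add: prob_space)
  finally show "(\<integral>\<omega>. (norm (H (\<theta> n \<omega>) (Xs (Suc n) \<omega>)))\<^sup>2 \<partial>M) \<le> K * (1 + (\<integral>\<omega>. (norm (\<theta> n \<omega>))\<^sup>2 \<partial>M))" .
qed

lemma theta_square_integrable: "integrable M (\<lambda>\<omega>. (norm (\<theta> n \<omega>))\<^sup>2)"
proof (induction n)
  case 0
  have "integrable M (\<lambda>\<omega>. (norm (\<theta> 0 \<omega>))\<^sup>2) \<longleftrightarrow> integrable M (\<lambda>\<omega>. (norm t0)\<^sup>2)"
    by (rule Bochner_Integration.integrable_cong) (auto simp: theta_0)
  then show ?case by simp
next
  case (Suc n)
  show ?case
  proof (rule Bochner_Integration.integrable_bound)
    show "integrable M (\<lambda>\<omega>. 2 * (norm (\<theta> n \<omega>))\<^sup>2 + 2 * ((\<gamma> (Suc n))\<^sup>2 * (norm (H (\<theta> n \<omega>) (Xs (Suc n) \<omega>)))\<^sup>2))"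
      using Suc H_theta_square(1)[OF Suc] by simp
    show "AE \<omega> in M. norm ((norm (\<theta> (Suc n) \<omega>))\<^sup>2)
      \<le> norm (2 * (norm (\<theta> n \<omega>))\<^sup>2 + 2 * ((\<gamma> (Suc n))\<^sup>2 * (norm (H (\<theta> n \<omega>) (Xs (Suc n) \<omega>)))\<^sup>2))"
    proof (rule AE_I2)
      fix \<omega> assume "\<omega> \<in> space M"
      then show "norm ((norm (\<theta> (Suc n) \<omega>))\<^sup>2)
        \<le> norm (2 * (norm (\<theta> n \<omega>))\<^sup>2 + 2 * ((\<gamma> (Suc n))\<^sup>2 * (norm (H (\<theta> n \<omega>) (Xs (Suc n) \<omega>)))\<^sup>2))"
        using norm_diff_square_le[of "\<theta> n \<omega>" "\<gamma> (Suc n) *\<^sub>R H (\<theta> n \<omega>) (Xs (Suc n) \<omega>)"]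
        by (simp add: theta_Suc power_mult_distrib)
    qed
  qed simp
qed

lemma diff_square_integrable: "integrable M (\<lambda>\<omega>. (norm (\<theta> n \<omega> - s))\<^sup>2)"
proof (rule Bochner_Integration.integrable_bound)
  show "integrable M (\<lambda>\<omega>. 2 * (norm (\<theta> n \<omega>))\<^sup>2 + 2 * (norm s)\<^sup>2)" using theta_square_integrable by simp
qed (auto intro!: AE_I2 order_trans[OF norm_diff_square_le])

text \<open>In expectation, \<open>H\<close> may be replaced by its mean \<open>h\<close> when
  paired with a direction determined by \<open>\<theta> n\<close>. Cauchy-Schwarz supplies the
  integrability that freezing asks for.\<close>

lemma inner_H_integrable:
  assumes [measurable]: "u \<in> borel_measurable borel" and u: "integrable M (\<lambda>\<omega>. (norm (u (\<theta> n \<omega>)))\<^sup>2)"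
  shows "integrable M (\<lambda>\<omega>. H (\<theta> n \<omega>) (Xs (Suc n) \<omega>) \<bullet> u (\<theta> n \<omega>))"
    and "(\<integral>\<omega>. H (\<theta> n \<omega>) (Xs (Suc n) \<omega>) \<bullet> u (\<theta> n \<omega>) \<partial>M) = (\<integral>\<omega>. h (\<theta> n \<omega>) \<bullet> u (\<theta> n \<omega>) \<partial>M)"
proof -
  show i: "integrable M (\<lambda>\<omega>. H (\<theta> n \<omega>) (Xs (Suc n) \<omega>) \<bullet> u (\<theta> n \<omega>))"
  proof (rule Bochner_Integration.integrable_bound)
    show "integrable M (\<lambda>\<omega>. norm (H (\<theta> n \<omega>) (Xs (Suc n) \<omega>)) * norm (u (\<theta> n \<omega>)))"
      by (rule integrable_mult_of_squares) (use H_theta_square(1)[OF theta_square_integrable] u in auto)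
    show "AE \<omega> in M. norm (H (\<theta> n \<omega>) (Xs (Suc n) \<omega>) \<bullet> u (\<theta> n \<omega>))
        \<le> norm (norm (H (\<theta> n \<omega>) (Xs (Suc n) \<omega>)) * norm (u (\<theta> n \<omega>)))"
      using Cauchy_Schwarz_ineq2 by auto
  qed simp
  have m: "(\<lambda>z. H (fst z) (snd z) \<bullet> u (fst z)) \<in> borel_measurable (borel \<Otimes>\<^sub>M N)"
    using H_measurable by measurable
  have inner: "(\<integral>x. H t x \<bullet> u t \<partial>\<mu>) = h t \<bullet> u t" for t
    unfolding h_def by (rule integral_inner_left) (rule H_integrable)
  show "(\<integral>\<omega>. H (\<theta> n \<omega>) (Xs (Suc n) \<omega>) \<bullet> u (\<theta> n \<omega>) \<partial>M) = (\<integral>\<omega>. h (\<theta> n \<omega>) \<bullet> u (\<theta> n \<omega>) \<partial>M)"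
    by (rule freezing(2)[OF theta_G, where \<phi>="\<lambda>t x. H t x \<bullet> u t", OF m i, unfolded inner])
qed

lemma square_step:
  assumes "\<omega> \<in> space M"
  shows "(norm (\<theta> (Suc n) \<omega> - s))\<^sup>2 = (norm (\<theta> n \<omega> - s))\<^sup>2
    - 2 * \<gamma> (Suc n) * (H (\<theta> n \<omega>) (Xs (Suc n) \<omega>) \<bullet> (\<theta> n \<omega> - s))
    + (\<gamma> (Suc n))\<^sup>2 * (norm (H (\<theta> n \<omega>) (Xs (Suc n) \<omega>)))\<^sup>2"
  unfolding theta_Suc[OF assms] power2_norm_eq_inner
  by (simp add: inner_simps inner_commute algebra_simps power2_eq_square)

text \<open>With directions of norm at most 1, the growth of \<open>H\<close> alone controls the
  noise. The factor 4 collects twice the bound for \<open>H\<close> and twice the bound for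
  \<open>h\<close>.\<close>

lemma martingale_part:
  assumes u[measurable]: "u \<in> borel_measurable borel" and u1: "\<And>t. norm (u t) \<le> 1"
  defines "D \<equiv> \<lambda>n \<omega>. \<gamma> (Suc n) * ((H (\<theta> n \<omega>) (Xs (Suc n) \<omega>) - h (\<theta> n \<omega>)) \<bullet> u (\<theta> n \<omega>))"
  shows "L2_martingale_differences M G D"
    and "(\<integral>\<omega>. (D n \<omega>)\<^sup>2 \<partial>M) \<le> (\<gamma> (Suc n))\<^sup>2 * (4 * K * (1 + (\<integral>\<omega>. (norm (\<theta> n \<omega>))\<^sup>2 \<partial>M)))"
proof -
  note iH = H_theta_square[OF theta_square_integrable]
  have [measurable]: "D n \<in> borel_measurable M" for n unfolding D_def by measurable
  have le: "(D n \<omega>)\<^sup>2 \<le> (\<gamma> (Suc n))\<^sup>2 * (2 * (norm (H (\<theta> n \<omega>) (Xs (Suc n) \<omega>)))\<^sup>2 + 2 * (K * (1 + (norm (\<theta> n \<omega>))\<^sup>2)))" for n \<omega>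
  proof -
    let ?a = "H (\<theta> n \<omega>) (Xs (Suc n) \<omega>) - h (\<theta> n \<omega>)"
    have "\<bar>?a \<bullet> u (\<theta> n \<omega>)\<bar> \<le> norm ?a * norm (u (\<theta> n \<omega>))" by (rule Cauchy_Schwarz_ineq2)
    also have "\<dots> \<le> norm ?a * 1" by (intro mult_left_mono u1) simp
    finally have "(?a \<bullet> u (\<theta> n \<omega>))\<^sup>2 \<le> (norm ?a)\<^sup>2" by (simp add: abs_le_square_iff[symmetric])
    also have "\<dots> \<le> 2 * (norm (H (\<theta> n \<omega>) (Xs (Suc n) \<omega>)))\<^sup>2 + 2 * (norm (h (\<theta> n \<omega>)))\<^sup>2"
      by (rule norm_diff_square_le)
    also have "\<dots> \<le> 2 * (norm (H (\<theta> n \<omega>) (Xs (Suc n) \<omega>)))\<^sup>2 + 2 * (K * (1 + (norm (\<theta> n \<omega>))\<^sup>2))"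
      using h_growth[of "\<theta> n \<omega>"] by simp
    finally show ?thesis unfolding D_def power_mult_distrib by (intro mult_left_mono) auto
  qed
  have ib: "integrable M (\<lambda>\<omega>. (\<gamma> (Suc n))\<^sup>2 * (2 * (norm (H (\<theta> n \<omega>) (Xs (Suc n) \<omega>)))\<^sup>2 + 2 * (K * (1 + (norm (\<theta> n \<omega>))\<^sup>2))))" for n
    using iH(1)[of n] theta_square_integrable[of n] by simp
  have iD: "integrable M (\<lambda>\<omega>. (D n \<omega>)\<^sup>2)" for n
    by (rule Bochner_Integration.integrable_bound[OF ib[of n]]) (auto intro!: AE_I2 order_trans[OF le])
  have "(\<integral>\<omega>. (D n \<omega>)\<^sup>2 \<partial>M) \<le> (\<integral>\<omega>. (\<gamma> (Suc n))\<^sup>2 * (2 * (norm (H (\<theta> n \<omega>) (Xs (Suc n) \<omega>)))\<^sup>2 + 2 * (K * (1 + (norm (\<theta> n \<omega>))\<^sup>2))) \<partial>M)"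
    by (rule integral_mono[OF iD ib le])
  also have "\<dots> = (\<gamma> (Suc n))\<^sup>2 * (2 * (\<integral>\<omega>. (norm (H (\<theta> n \<omega>) (Xs (Suc n) \<omega>)))\<^sup>2 \<partial>M)
      + 2 * (K * (1 + (\<integral>\<omega>. (norm (\<theta> n \<omega>))\<^sup>2 \<partial>M))))"
    using iH(1)[of n] theta_square_integrable[of n] by (simp add: prob_space)
  also have "\<dots> \<le> (\<gamma> (Suc n))\<^sup>2 * (4 * K * (1 + (\<integral>\<omega>. (norm (\<theta> n \<omega>))\<^sup>2 \<partial>M)))"
    using iH(2)[of n] by (intro mult_left_mono) auto
  finally show "(\<integral>\<omega>. (D n \<omega>)\<^sup>2 \<partial>M) \<le> (\<gamma> (Suc n))\<^sup>2 * (4 * K * (1 + (\<integral>\<omega>. (norm (\<theta> n \<omega>))\<^sup>2 \<partial>M)))" .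
  show "L2_martingale_differences M G D"
  proof unfold_locales
    fix n
    show "subalgebra M (G n)" by (rule subalgebra_G)
    show "sets (G n) \<subseteq> sets (G (Suc n))" by (rule G_mono)
    have [measurable]: "\<theta> n \<in> borel_measurable (G (Suc n))" by (rule measurable_G_Suc[OF theta_G])
    have [measurable]: "(\<lambda>\<omega>. H (\<theta> n \<omega>) (Xs (Suc n) \<omega>)) \<in> borel_measurable (G (Suc n))"
      by (rule H_compose) (auto intro: Xs_G)
    show "D n \<in> borel_measurable (G (Suc n))" unfolding D_def by measurable
    show "integrable M (\<lambda>\<omega>. (D n \<omega>)\<^sup>2)" by (rule iD)
  next
    fix n and g :: "'a \<Rightarrow> real" assume g: "g \<in> borel_measurable (G n)" and ig: "integrable M (\<lambda>\<omega>. (g \<omega>)\<^sup>2)"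
    have [measurable]: "g \<in> borel_measurable M" using g by (rule measurable_G_M)
    \<comment> \<open>The test function \<open>g\<close> is an arbitrary past quantity, so it is
      frozen jointly with \<open>\<theta> n\<close>; the inner integral then vanishes because
      \<open>h\<close> is the mean of \<open>H\<close>.\<close>
    have Z: "(\<lambda>\<omega>. (g \<omega>, \<theta> n \<omega>)) \<in> measurable (G n) (borel \<Otimes>\<^sub>M borel)"
      using g theta_G by (rule measurable_Pair)
    define \<phi> where "\<phi> = (\<lambda>z x. fst z * (\<gamma> (Suc n) * ((H (snd z) x - h (snd z)) \<bullet> u (snd z))))"
    have Hm: "(\<lambda>z. H (snd (fst z)) (snd z)) \<in> borel_measurable ((borel \<Otimes>\<^sub>M borel) \<Otimes>\<^sub>M N)"
      by (rule H_compose) auto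
    have m: "(\<lambda>z. \<phi> (fst z) (snd z)) \<in> borel_measurable ((borel \<Otimes>\<^sub>M borel) \<Otimes>\<^sub>M N)"
      unfolding \<phi>_def using Hm by measurable
    have eq: "\<phi> (g \<omega>, \<theta> n \<omega>) (Xs (Suc n) \<omega>) = g \<omega> * D n \<omega>" for \<omega>
      unfolding \<phi>_def D_def by simp
    have i: "integrable M (\<lambda>\<omega>. \<phi> (g \<omega>, \<theta> n \<omega>) (Xs (Suc n) \<omega>))"
      unfolding eq by (rule integrable_mult_of_squares[OF _ _ ig iD]) auto
    interpret mu: prob_space \<mu> by (rule prob_space_mu)
    have zero: "(\<integral>x. \<phi> z x \<partial>\<mu>) = 0" for z
      using H_integrable[of "snd z"] mu.prob_space unfolding \<phi>_def by (simp add: h_def inner_diff_left)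
    show "(\<integral>\<omega>. g \<omega> * D n \<omega> \<partial>M) = 0"
      using freezing(2)[OF Z m i] unfolding eq zero by simp
  qed
qed

end

section \<open>Almost sure convergence under a drift condition\<close>

lemma AE_summable_of_summable_integral:
  fixes f :: "nat \<Rightarrow> 'a \<Rightarrow> real"
  assumes f: "\<And>n. integrable M (f n)" "\<And>n x. 0 \<le> f n x" and s: "summable (\<lambda>n. \<integral>x. f n x \<partial>M)"
  shows "AE x in M. summable (\<lambda>n. f n x)"
proof -
  have "(\<integral>\<^sup>+x. (\<Sum>n. ennreal (f n x)) \<partial>M) = (\<Sum>n. \<integral>\<^sup>+x. ennreal (f n x) \<partial>M)"
    using f(1) by (intro nn_integral_suminf) auto
  also have "\<dots> = (\<Sum>n. ennreal (\<integral>x. f n x \<partial>M))"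
    using f by (intro suminf_cong nn_integral_eq_integral) auto
  also have "\<dots> = ennreal (\<Sum>n. \<integral>x. f n x \<partial>M)"
    by (rule suminf_ennreal2) (use f s in auto)
  finally have "(\<integral>\<^sup>+x. (\<Sum>n. ennreal (f n x)) \<partial>M) \<noteq> \<infinity>" by simp
  then have "AE x in M. (\<Sum>n. ennreal (f n x)) \<noteq> \<infinity>"
    using f(1) by (intro nn_integral_noteq_infinite) auto
  then show ?thesis by eventually_elim (use f in \<open>auto intro: summable_suminf_not_top\<close>)
qed

text \<open>\<open>drift\<close> has the shape of a subgradient inequality with \<open>h\<close> in
  the role of the gradient, demanded only against minimizers. \<open>lsc\<close> is sequential and
  restricted to sequences whose values converge.\<close>

locale lyapunov_stochastic_approximation = stochastic_approximation +
  fixes L \<rho> :: "'c \<Rightarrow> real"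
  assumes drift: "\<And>s t. s \<in> Argmin L \<Longrightarrow> \<rho> t * (L t - L s) \<le> h t \<bullet> (t - s)"
    and lsc: "\<And>u t l. u \<longlonglongrightarrow> t \<Longrightarrow> (\<lambda>n. L (u n)) \<longlonglongrightarrow> l \<Longrightarrow> L t \<le> l"
    and rho_lower: "\<And>R. \<exists>r>0. \<forall>t. norm t \<le> R \<longrightarrow> r \<le> \<rho> t"
    and Argmin_nonempty: "Argmin L \<noteq> {}"
    and gamma_div: "\<not> summable (\<lambda>n. \<gamma> (Suc n))"
begin

lemma rho_pos: "0 < \<rho> t"
  using rho_lower[of "norm t"] by force

lemma drift_nonneg:
  assumes s: "s \<in> Argmin L" shows "0 \<le> h t \<bullet> (t - s)"
proof -
  have "0 \<le> \<rho> t * (L t - L s)"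
    using s rho_pos[of t] by (intro mult_nonneg_nonneg) (auto simp: Argmin_def)
  then show ?thesis using drift[OF s, of t] by linarith
qed

text \<open>In the expansion of the squared distance the drift term has nonnegative mean and is
  dropped. Adding 1 to the second moment makes the remaining recursion purely
  multiplicative.\<close>

lemma second_moment_bounded:
  assumes s: "s \<in> Argmin L"
  obtains B where "\<And>n. (\<integral>\<omega>. (norm (\<theta> n \<omega> - s))\<^sup>2 \<partial>M) \<le> B" "0 \<le> B"
proof -
  define a where "a n = 1 + (\<integral>\<omega>. (norm (\<theta> n \<omega> - s))\<^sup>2 \<partial>M)" for n
  \<comment> \<open>The factor 2 comes from recentring \<open>\<theta> n\<close> at
    \<open>s\<close>; the constant terms are absorbed by \<open>1 \<le> a n\<close>.\<close>
  define C where "C = 2 * K * (1 + (norm s)\<^sup>2)"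
  define b where "b = (\<lambda>n. C * (\<gamma> (Suc n))\<^sup>2)"
  have a1: "1 \<le> a n" for n unfolding a_def by simp
  have C0: "0 \<le> C" unfolding C_def using K_nonneg by simp
  have "a (Suc n) \<le> a n * (1 + b n)" for n
  proof -
    note iH = H_theta_square[OF theta_square_integrable[of n]]
    note iU = diff_square_integrable[of _ s]
    have u: "(\<lambda>t. t - s) \<in> borel_measurable borel" by simp
    note inn = inner_H_integrable[OF u iU[of n]]
    have "(\<integral>\<omega>. (norm (\<theta> (Suc n) \<omega> - s))\<^sup>2 \<partial>M) = (\<integral>\<omega>. (norm (\<theta> n \<omega> - s))\<^sup>2
      - 2 * \<gamma> (Suc n) * (H (\<theta> n \<omega>) (Xs (Suc n) \<omega>) \<bullet> (\<theta> n \<omega> - s))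
      + (\<gamma> (Suc n))\<^sup>2 * (norm (H (\<theta> n \<omega>) (Xs (Suc n) \<omega>)))\<^sup>2 \<partial>M)"
      by (rule Bochner_Integration.integral_cong[OF refl square_step])
    also have "\<dots> = (\<integral>\<omega>. (norm (\<theta> n \<omega> - s))\<^sup>2 \<partial>M)
      - 2 * \<gamma> (Suc n) * (\<integral>\<omega>. h (\<theta> n \<omega>) \<bullet> (\<theta> n \<omega> - s) \<partial>M)
      + (\<gamma> (Suc n))\<^sup>2 * (\<integral>\<omega>. (norm (H (\<theta> n \<omega>) (Xs (Suc n) \<omega>)))\<^sup>2 \<partial>M)"
      using iU inn(1) iH(1) unfolding inn(2)[symmetric] by simp
    also have "\<dots> \<le> (\<integral>\<omega>. (norm (\<theta> n \<omega> - s))\<^sup>2 \<partial>M)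
      + (\<gamma> (Suc n))\<^sup>2 * (\<integral>\<omega>. (norm (H (\<theta> n \<omega>) (Xs (Suc n) \<omega>)))\<^sup>2 \<partial>M)"
    proof -
      have "0 \<le> (\<integral>\<omega>. h (\<theta> n \<omega>) \<bullet> (\<theta> n \<omega> - s) \<partial>M)"
        by (intro integral_nonneg_AE AE_I2 drift_nonneg s)
      then show ?thesis using gamma_pos[of "Suc n"] by simp
    qed
    also have "(\<integral>\<omega>. (norm (H (\<theta> n \<omega>) (Xs (Suc n) \<omega>)))\<^sup>2 \<partial>M) \<le> K * (1 + (\<integral>\<omega>. (norm (\<theta> n \<omega>))\<^sup>2 \<partial>M))"
      by (rule iH(2))
    also have "(\<integral>\<omega>. (norm (\<theta> n \<omega>))\<^sup>2 \<partial>M) \<le> (\<integral>\<omega>. 2 * (norm (\<theta> n \<omega> - s))\<^sup>2 + 2 * (norm s)\<^sup>2 \<partial>M)"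
    proof (rule integral_mono[OF theta_square_integrable])
      show "(norm (\<theta> n \<omega>))\<^sup>2 \<le> 2 * (norm (\<theta> n \<omega> - s))\<^sup>2 + 2 * (norm s)\<^sup>2" for \<omega>
        using norm_diff_square_le[of "\<theta> n \<omega> - s" "- s"] by simp
    qed (use iU in simp)
    also have "\<dots> = 2 * (a n - 1) + 2 * (norm s)\<^sup>2"
      unfolding a_def using iU[of n] by (simp add: prob_space)
    also have "K * (1 + (2 * (a n - 1) + 2 * (norm s)\<^sup>2)) \<le> C * a n"
    proof -
      have "(norm s)\<^sup>2 * 1 \<le> (norm s)\<^sup>2 * a n" using a1[of n] by (intro mult_left_mono) auto
      then have "1 + (2 * (a n - 1) + 2 * (norm s)\<^sup>2) \<le> 2 * (1 + (norm s)\<^sup>2) * a n"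
        by (simp add: algebra_simps)
      from mult_left_mono[OF this K_nonneg] show ?thesis unfolding C_def by (simp add: algebra_simps)
    qed
    finally have "(\<integral>\<omega>. (norm (\<theta> (Suc n) \<omega> - s))\<^sup>2 \<partial>M)
      \<le> (\<integral>\<omega>. (norm (\<theta> n \<omega> - s))\<^sup>2 \<partial>M) + (\<gamma> (Suc n))\<^sup>2 * (C * a n)"
      using K_nonneg by (simp add: mult_left_mono)
    then show ?thesis unfolding a_def b_def by (simp add: algebra_simps)
  qed
  moreover have "summable b" unfolding b_def using gamma_square by (rule summable_mult)
  moreover have "0 \<le> a n" "0 \<le> b n" for n using a1[of n] C0 unfolding b_def by auto
  ultimately have a: "a n \<le> a 0 * exp (suminf b)" for n by (intro bounded_multiplicative_recursion)
  show thesis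
  proof (rule that[of "a 0 * exp (suminf b)"])
    show "(\<integral>\<omega>. (norm (\<theta> n \<omega> - s))\<^sup>2 \<partial>M) \<le> a 0 * exp (suminf b)" for n
      using a[of n] unfolding a_def[of n] by linarith
    show "0 \<le> a 0 * exp (suminf b)" using a[of 0] a1[of 0] by linarith
  qed
qed

text \<open>The Lyapunov function is \<open>S = sqrt (1 + (norm (\<theta> n - s))\<^sup>2)\<close> rather than its square:
  its martingale part is bounded in \<open>L\<^sup>2\<close>, so no localisation is needed.\<close>
lemma AE_distance_converges:
  assumes s: "s \<in> Argmin L"
  shows "AE \<omega> in M. convergent (\<lambda>n. norm (\<theta> n \<omega> - s)) \<and>
    summable (\<lambda>n. \<gamma> (Suc n) * (h (\<theta> n \<omega>) \<bullet> (\<theta> n \<omega> - s) / sqrt (1 + (norm (\<theta> n \<omega> - s))\<^sup>2)))"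
proof -
  \<comment> \<open>The growth of \<open>H\<close> is measured from the origin, so the bound around
    the minimizer \<open>s\<close> is recentred at 0, which may fail to be a minimizer.\<close>
  obtain B where B: "\<And>n. (\<integral>\<omega>. (norm (\<theta> n \<omega> - 0))\<^sup>2 \<partial>M) \<le> B" "0 \<le> B"
  proof -
    obtain B where B: "\<And>n. (\<integral>\<omega>. (norm (\<theta> n \<omega> - s))\<^sup>2 \<partial>M) \<le> B" "0 \<le> B"
      using second_moment_bounded[OF s] by blast
    have "(\<integral>\<omega>. (norm (\<theta> n \<omega>))\<^sup>2 \<partial>M) \<le> 2 * B + 2 * (norm s)\<^sup>2" for n
    proof -
      have "(\<integral>\<omega>. (norm (\<theta> n \<omega>))\<^sup>2 \<partial>M) \<le> (\<integral>\<omega>. 2 * (norm (\<theta> n \<omega> - s))\<^sup>2 + 2 * (norm s)\<^sup>2 \<partial>M)"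
      proof (rule integral_mono[OF theta_square_integrable])
        show "(norm (\<theta> n \<omega>))\<^sup>2 \<le> 2 * (norm (\<theta> n \<omega> - s))\<^sup>2 + 2 * (norm s)\<^sup>2" for \<omega>
          using norm_diff_square_le[of "\<theta> n \<omega> - s" "- s"] by simp
      qed (use diff_square_integrable in simp)
      also have "\<dots> \<le> 2 * B + 2 * (norm s)\<^sup>2"
        using diff_square_integrable[of n s] B(1)[of n] by (simp add: prob_space)
      finally show ?thesis .
    qed
    then show thesis using B(2) by (intro that[of "2 * B + 2 * (norm s)\<^sup>2"]) auto
  qed
  define S where "S = (\<lambda>t. sqrt (1 + (norm (t - s))\<^sup>2))"
  \<comment> \<open>\<open>u\<close> is the gradient of \<open>S\<close>; since \<open>S\<close>
    dominates the distance to \<open>s\<close>, its norm is at most 1.\<close>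
  define u where "u = (\<lambda>t. (1 / S t) *\<^sub>R (t - s))"
  have S1: "1 \<le> S t" for t unfolding S_def by simp
  have S2: "(S t)\<^sup>2 = 1 + (norm (t - s))\<^sup>2" for t unfolding S_def by (simp add: add_nonneg_nonneg)
  have u1: "norm (u t) \<le> 1" for t
  proof -
    have "norm (t - s) \<le> S t" unfolding S_def by (rule real_le_rsqrt) simp
    then show ?thesis unfolding u_def using S1[of t] by simp
  qed
  have [measurable]: "S \<in> borel_measurable borel" unfolding S_def by measurable
  have um[measurable]: "u \<in> borel_measurable borel" unfolding u_def by measurable
  define D where "D = (\<lambda>n \<omega>. \<gamma> (Suc n) * ((H (\<theta> n \<omega>) (Xs (Suc n) \<omega>) - h (\<theta> n \<omega>)) \<bullet> u (\<theta> n \<omega>)))"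
  define Q where "Q = (\<lambda>n \<omega>. (\<gamma> (Suc n))\<^sup>2 * (norm (H (\<theta> n \<omega>) (Xs (Suc n) \<omega>)))\<^sup>2)"
  have mp: "L2_martingale_differences M G D"
    "\<And>n. (\<integral>\<omega>. (D n \<omega>)\<^sup>2 \<partial>M) \<le> (\<gamma> (Suc n))\<^sup>2 * (4 * K * (1 + (\<integral>\<omega>. (norm (\<theta> n \<omega>))\<^sup>2 \<partial>M)))"
    unfolding D_def by (rule martingale_part[OF um u1])+
  note iH = H_theta_square[OF theta_square_integrable]
  have g4: "summable (\<lambda>n. (\<gamma> (Suc n))\<^sup>2 * (4 * K * (1 + B)))" using gamma_square by (rule summable_mult2)
  have le4: "(\<gamma> (Suc n))\<^sup>2 * (K' * (1 + (\<integral>\<omega>. (norm (\<theta> n \<omega>))\<^sup>2 \<partial>M))) \<le> (\<gamma> (Suc n))\<^sup>2 * (4 * K * (1 + B))"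
    if "0 \<le> K'" "K' \<le> 4 * K" for n K'
    using B(1)[of n] that by (intro mult_left_mono mult_mono) auto
  have "summable (\<lambda>n. \<integral>\<omega>. (D n \<omega>)\<^sup>2 \<partial>M)"
    by (rule summable_comparison_test'[OF g4, of 0])
      (use order_trans[OF mp(2) le4[of "4 * K"]] K_nonneg in simp)
  then have AED: "AE \<omega> in M. summable (\<lambda>n. D n \<omega>)"
    by (rule L2_martingale_differences.AE_summable[OF mp(1)])
  have "summable (\<lambda>n. \<integral>\<omega>. Q n \<omega> \<partial>M)"
  proof (rule summable_comparison_test'[OF g4, of 0])
    fix n
    have "(\<integral>\<omega>. Q n \<omega> \<partial>M) \<le> (\<gamma> (Suc n))\<^sup>2 * (K * (1 + (\<integral>\<omega>. (norm (\<theta> n \<omega>))\<^sup>2 \<partial>M)))"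
      unfolding Q_def using iH(2)[of n] by (simp add: mult_left_mono)
    also have "\<dots> \<le> (\<gamma> (Suc n))\<^sup>2 * (4 * K * (1 + B))" by (rule le4) (use K_nonneg in auto)
    finally show "norm (\<integral>\<omega>. Q n \<omega> \<partial>M) \<le> (\<gamma> (Suc n))\<^sup>2 * (4 * K * (1 + B))"
      by (simp add: Q_def)
  qed
  then have AEQ: "AE \<omega> in M. summable (\<lambda>n. Q n \<omega>)"
    by (intro AE_summable_of_summable_integral) (use iH(1) in \<open>auto simp: Q_def\<close>)
  from AED AEQ AE_space show ?thesis
  proof eventually_elim
    case (elim \<omega>)
    \<comment> \<open>The tangent inequality at the current point, with \<open>H\<close> split into
      \<open>h\<close> plus noise. The remainder \<open>Q n \<omega> - D n \<omega>\<close> has no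
      sign, but both of its series converge at this \<open>\<omega>\<close>.\<close>
    have step: "S (\<theta> (Suc n) \<omega>) \<le> S (\<theta> n \<omega>) - \<gamma> (Suc n) * (h (\<theta> n \<omega>) \<bullet> u (\<theta> n \<omega>)) + (Q n \<omega> - D n \<omega>)" for n
    proof -
      let ?a = "1 + (norm (\<theta> n \<omega> - s))\<^sup>2" and ?b = "1 + (norm (\<theta> (Suc n) \<omega> - s))\<^sup>2"
      let ?H = "H (\<theta> n \<omega>) (Xs (Suc n) \<omega>)"
      have "S (\<theta> (Suc n) \<omega>) \<le> S (\<theta> n \<omega>) + (?b - ?a) / (2 * S (\<theta> n \<omega>))"
        unfolding S_def by (rule sqrt_le_tangent) (auto intro: add_pos_nonneg)
      also have "?b - ?a = Q n \<omega> - 2 * \<gamma> (Suc n) * (?H \<bullet> (\<theta> n \<omega> - s))"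
        unfolding square_step[OF elim(3)] Q_def by simp
      also have "\<dots> / (2 * S (\<theta> n \<omega>)) = Q n \<omega> / (2 * S (\<theta> n \<omega>)) - \<gamma> (Suc n) * (?H \<bullet> u (\<theta> n \<omega>))"
        unfolding u_def by (simp add: diff_divide_distrib)
      also have "Q n \<omega> / (2 * S (\<theta> n \<omega>)) \<le> Q n \<omega> / 1"
        using S1[of "\<theta> n \<omega>"] by (intro divide_left_mono) (auto simp: Q_def)
      finally show ?thesis unfolding D_def by (simp add: inner_diff_left algebra_simps)
    qed
    have v0: "0 \<le> \<gamma> (Suc n) * (h (\<theta> n \<omega>) \<bullet> u (\<theta> n \<omega>))" for n
      using gamma_pos[of "Suc n"] drift_nonneg[OF s, of "\<theta> n \<omega>"] S1[of "\<theta> n \<omega>"]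
      unfolding u_def by simp
    have S0: "0 \<le> S (\<theta> n \<omega>)" for n using S1[of "\<theta> n \<omega>"] by simp
    have w: "summable (\<lambda>n. Q n \<omega> - D n \<omega>)" using elim by (intro summable_diff)
    note c = summable_of_almost_decreasing[OF S0 v0 w step]
    obtain l where "(\<lambda>n. S (\<theta> n \<omega>)) \<longlonglongrightarrow> l" using c(1) unfolding convergent_def by blast
    then have "(\<lambda>n. sqrt ((S (\<theta> n \<omega>))\<^sup>2 - 1)) \<longlonglongrightarrow> sqrt (l\<^sup>2 - 1)" by (intro tendsto_intros)
    then have "convergent (\<lambda>n. norm (\<theta> n \<omega> - s))" unfolding S2 convergent_def by auto
    moreover have "h t \<bullet> u t = h t \<bullet> (t - s) / sqrt (1 + (norm (t - s))\<^sup>2)" for t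
      unfolding u_def S_def by simp
    ultimately show ?case using c(2) by simp
  qed
qed

text \<open>The null set outside which a distance converges depends on the minimizer, so only
  countably many minimizers can be treated at once; density reaches the others.\<close>

theorem AE_converges_to_Argmin:
  "\<exists>\<theta>star. \<theta>star \<in> borel_measurable M \<and> (\<forall>\<omega>\<in>space M. \<theta>star \<omega> \<in> Argmin L)
    \<and> integrable M (\<lambda>\<omega>. (norm (\<theta>star \<omega>))\<^sup>2) \<and> (AE \<omega> in M. (\<lambda>n. \<theta> n \<omega>) \<longlonglongrightarrow> \<theta>star \<omega>)"
proof -
  obtain D where D: "countable D" "D \<subseteq> Argmin L" "Argmin L \<subseteq> closure D" by (rule separable)
  then obtain s0 where s0: "s0 \<in> D" using Argmin_nonempty by fastforce
  \<comment> \<open>The summable series carries the denominator \<open>sqrt (1 + ...)\<close>.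
    Dividing \<open>\<rho>\<close> by it preserves a positive lower bound on balls.\<close>
  define \<rho>' where "\<rho>' = (\<lambda>t. \<rho> t / sqrt (1 + (norm (t - s0))\<^sup>2))"
  have rho': "\<exists>r>0. \<forall>t. norm t \<le> R \<longrightarrow> r \<le> \<rho>' t" for R
  proof -
    obtain r where r: "r > 0" "\<And>t. norm t \<le> R \<Longrightarrow> r \<le> \<rho> t" using rho_lower[of R] by blast
    have "r / sqrt (1 + (R + norm s0)\<^sup>2) \<le> \<rho>' t" if t: "norm t \<le> R" for t
    proof -
      have "norm (t - s0) \<le> R + norm s0" using norm_triangle_ineq4[of t s0] t by linarith
      then have "(norm (t - s0))\<^sup>2 \<le> (R + norm s0)\<^sup>2" by (intro power_mono) auto
      then show ?thesis unfolding \<rho>'_def using r t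
        by (intro frac_le) (auto simp: add_pos_nonneg intro: less_imp_le[OF rho_pos])
    qed
    moreover have "0 < r / sqrt (1 + (R + norm s0)\<^sup>2)" using r by (simp add: add_pos_nonneg)
    ultimately show ?thesis by blast
  qed
  have "AE \<omega> in M. \<forall>s\<in>D. convergent (\<lambda>n. norm (\<theta> n \<omega> - s)) \<and>
    summable (\<lambda>n. \<gamma> (Suc n) * (h (\<theta> n \<omega>) \<bullet> (\<theta> n \<omega> - s) / sqrt (1 + (norm (\<theta> n \<omega> - s))\<^sup>2)))"
    unfolding AE_ball_countable[OF D(1)] using AE_distance_converges D(2) by blast
  then have "AE \<omega> in M. \<exists>t\<in>Argmin L. (\<lambda>n. \<theta> n \<omega>) \<longlonglongrightarrow> t"
  proof eventually_elim
    case (elim \<omega>)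
    have "summable (\<lambda>n. \<gamma> (Suc n) * (\<rho>' (\<theta> n \<omega>) * (L (\<theta> n \<omega>) - L s0)))"
    proof (rule summable_comparison_test'[where N=0])
      show "summable (\<lambda>n. \<gamma> (Suc n) * (h (\<theta> n \<omega>) \<bullet> (\<theta> n \<omega> - s0) / sqrt (1 + (norm (\<theta> n \<omega> - s0))\<^sup>2)))"
        using elim s0 by blast
      fix n
      have s0': "s0 \<in> Argmin L" using s0 D by blast
      have g: "0 \<le> \<gamma> (Suc n)" using gamma_pos[of "Suc n"] by simp
      have p: "0 \<le> \<rho>' (\<theta> n \<omega>) * (L (\<theta> n \<omega>) - L s0)"
        using s0' rho_pos[of "\<theta> n \<omega>"] unfolding \<rho>'_def Argmin_def by (intro mult_nonneg_nonneg) auto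
      have le: "\<rho>' (\<theta> n \<omega>) * (L (\<theta> n \<omega>) - L s0) \<le> h (\<theta> n \<omega>) \<bullet> (\<theta> n \<omega> - s0) / sqrt (1 + (norm (\<theta> n \<omega> - s0))\<^sup>2)"
        using drift[OF s0', of "\<theta> n \<omega>"] unfolding \<rho>'_def by (simp add: divide_right_mono add_nonneg_nonneg)
      show "norm (\<gamma> (Suc n) * (\<rho>' (\<theta> n \<omega>) * (L (\<theta> n \<omega>) - L s0)))
        \<le> \<gamma> (Suc n) * (h (\<theta> n \<omega>) \<bullet> (\<theta> n \<omega> - s0) / sqrt (1 + (norm (\<theta> n \<omega> - s0))\<^sup>2))"
        using mult_left_mono[OF le g] mult_nonneg_nonneg[OF g p]
        by (simp only: real_norm_def abs_of_nonneg)
    qed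
    then show ?case
      using elim by (intro convergent_to_minimizer[OF D(2,3) s0 _ lsc gamma_pos gamma_div rho']) auto
  qed
  then obtain Z where Z: "\<And>\<omega>. \<omega> \<in> space M - Z \<Longrightarrow> \<exists>t\<in>Argmin L. (\<lambda>n. \<theta> n \<omega>) \<longlonglongrightarrow> t" "Z \<in> null_sets M"
    by (rule AE_E3) blast
  have [measurable]: "Z \<in> sets M" using Z(2) by auto
  \<comment> \<open>The default \<open>s0\<close> on the null set puts \<open>T\<close> in
    \<open>Argmin L\<close> at every point of the space, not only almost everywhere.\<close>
  define T where "T = (\<lambda>\<omega>. if \<omega> \<in> Z then s0 else lim (\<lambda>n. \<theta> n \<omega>))"
  have Tm[measurable]: "T \<in> borel_measurable M" unfolding T_def by measurable
  have TA: "T \<omega> \<in> Argmin L" if "\<omega> \<in> space M" for \<omega>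
    using Z(1)[of \<omega>] that s0 D(2) unfolding T_def by (auto dest: limI)
  have Tlim: "(\<lambda>n. \<theta> n \<omega>) \<longlonglongrightarrow> T \<omega>" if "\<omega> \<in> space M - Z" for \<omega>
    using Z(1)[of \<omega>] that unfolding T_def by (auto dest: limI)
  have AElim: "AE \<omega> in M. (\<lambda>n. \<theta> n \<omega>) \<longlonglongrightarrow> T \<omega>"
    by (rule AE_I'[OF Z(2)]) (use Tlim in auto)
  \<comment> \<open>A second moment bound uniform in \<open>n\<close>, to be passed to the limit by
    Fatou's lemma.\<close>
  obtain B where B: "\<And>n. (\<integral>\<omega>. (norm (\<theta> n \<omega> - s0))\<^sup>2 \<partial>M) \<le> B"
    using second_moment_bounded[of s0] s0 D(2) by blast
  have "(\<integral>\<^sup>+\<omega>. ennreal ((norm (T \<omega> - s0))\<^sup>2) \<partial>M) \<le> (\<integral>\<^sup>+\<omega>. liminf (\<lambda>n. ennreal ((norm (\<theta> n \<omega> - s0))\<^sup>2)) \<partial>M)"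
  proof (rule nn_integral_mono_AE)
    show "AE \<omega> in M. ennreal ((norm (T \<omega> - s0))\<^sup>2) \<le> liminf (\<lambda>n. ennreal ((norm (\<theta> n \<omega> - s0))\<^sup>2))"
      using AElim
    proof eventually_elim
      case (elim \<omega>)
      then have "(\<lambda>n. ennreal ((norm (\<theta> n \<omega> - s0))\<^sup>2)) \<longlonglongrightarrow> ennreal ((norm (T \<omega> - s0))\<^sup>2)"
        by (intro tendsto_ennrealI tendsto_intros)
      from lim_imp_Liminf[OF sequentially_bot this] show ?case by (simp only: order_refl)
    qed
  qed
  also have "\<dots> \<le> liminf (\<lambda>n. \<integral>\<^sup>+\<omega>. ennreal ((norm (\<theta> n \<omega> - s0))\<^sup>2) \<partial>M)"
    by (rule nn_integral_liminf) simp
  also have "\<dots> \<le> liminf (\<lambda>n. ennreal B)"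
    by (intro Liminf_mono always_eventually allI)
      (simp add: nn_integral_eq_integral[OF diff_square_integrable] ennreal_leI B)
  also have "\<dots> < \<infinity>" by (simp add: Liminf_const)
  finally have iT: "integrable M (\<lambda>\<omega>. (norm (T \<omega> - s0))\<^sup>2)" by (intro integrableI_bounded) auto
  have "integrable M (\<lambda>\<omega>. (norm (T \<omega>))\<^sup>2)"
  proof (rule Bochner_Integration.integrable_bound)
    show "integrable M (\<lambda>\<omega>. 2 * (norm (T \<omega> - s0))\<^sup>2 + 2 * (norm s0)\<^sup>2)" using iT by simp
    show "AE \<omega> in M. norm ((norm (T \<omega>))\<^sup>2) \<le> norm (2 * (norm (T \<omega> - s0))\<^sup>2 + 2 * (norm s0)\<^sup>2)"
    proof (rule AE_I2)
      show "norm ((norm (T \<omega>))\<^sup>2) \<le> norm (2 * (norm (T \<omega> - s0))\<^sup>2 + 2 * (norm s0)\<^sup>2)" for \<omega>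
        using norm_diff_square_le[of "T \<omega> - s0" "- s0"] by simp
    qed
  qed simp
  with TA AElim Tm show ?thesis by blast
qed

end

section \<open>Norm, measure and moment inequalities\<close>

text \<open>Since \<open>b - 1 \<le> 0\<close>, the factor \<open>x powr (b - 1)\<close> can only
  grow when the base shrinks from \<open>s + t\<close> to \<open>s\<close> or to
  \<open>t\<close>.\<close>

lemma powr_add_le:
  fixes s t b :: real
  assumes "0 \<le> s" "0 \<le> t" "0 \<le> b" "b \<le> 1"
  shows "(s + t) powr b \<le> s powr b + t powr b"
proof (cases "s = 0 \<or> t = 0")
  case False
  then have pos: "s > 0" "t > 0" "s + t > 0" using assms by auto
  have split: "x powr b = x * x powr (b - 1)" if "x > 0" for x :: real
    using powr_add[of x 1 "b - 1"] that by simp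
  have "(s + t) powr b = s * (s + t) powr (b - 1) + t * (s + t) powr (b - 1)"
    using split[OF pos(3)] by (simp add: distrib_right)
  also have "\<dots> \<le> s * s powr (b - 1) + t * t powr (b - 1)"
    using assms pos by (intro add_mono mult_left_mono powr_mono2') auto
  also have "\<dots> = s powr b + t powr b" using split pos by simp
  finally show ?thesis .
qed auto

text \<open>Midpoint concavity of the power. Young's inequality is applied to each term against the
  mean \<open>m\<close>, and the linear right-hand sides add up to \<open>2 * m\<close>.\<close>

lemma powr_mean_le:
  fixes s t b :: real
  assumes "0 \<le> s" "0 \<le> t" "0 \<le> b" "b \<le> 1"
  shows "s powr b + t powr b \<le> 2 * ((s + t) / 2) powr b"
proof (cases "s + t = 0")
  case True then show ?thesis using assms by (simp add: add_nonneg_eq_0_iff)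
next
  case False
  define m where "m = (s + t) / 2"
  have m: "m > 0" using False assms unfolding m_def by simp
  have y: "x powr b * m powr (1 - b) \<le> b * x + (1 - b) * m" if "0 \<le> x" for x
    by (cases "x = 0") (use assms m that in \<open>auto intro: Youngs_inequality_0\<close>)
  have "(s powr b + t powr b) * m powr (1 - b) \<le> b * (s + t) + 2 * (1 - b) * m"
    using y[OF assms(1)] y[OF assms(2)] by (simp add: algebra_simps)
  also have "\<dots> = 2 * m" unfolding m_def by (simp add: field_simps)
  also have "\<dots> = 2 * m powr b * m powr (1 - b)" using m by (simp add: powr_add[symmetric])
  finally show ?thesis using m unfolding m_def by (simp add: mult_le_cancel_right)
qed

text \<open>A Clarkson-type inequality; for \<open>a = 2\<close> it is the parallelogram law. Powers
  of the norm are powers of its square with exponent \<open>a / 2 \<le> 1\<close>, so concavity, the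
  parallelogram identity and subadditivity can be chained.\<close>

lemma norm_powr_parallelogram:
  fixes u v :: "'v::real_inner"
  assumes "1 \<le> a" "a \<le> 2"
  shows "norm (u + v) powr a + norm (u - v) powr a \<le> 2 * (norm u powr a + norm v powr a)"
proof -
  have sq: "norm z powr a = ((norm z)\<^sup>2) powr (a / 2)" for z :: 'v
    by (cases "z = 0") (simp_all add: powr_powr flip: powr_numeral)
  have "norm (u + v) powr a + norm (u - v) powr a
      \<le> 2 * (((norm (u + v))\<^sup>2 + (norm (u - v))\<^sup>2) / 2) powr (a / 2)"
    unfolding sq by (rule powr_mean_le) (use assms in auto)
  also have "((norm (u + v))\<^sup>2 + (norm (u - v))\<^sup>2) / 2 = (norm u)\<^sup>2 + (norm v)\<^sup>2"
    unfolding power2_norm_eq_inner by (simp add: inner_simps inner_commute)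
  also have "((norm u)\<^sup>2 + (norm v)\<^sup>2) powr (a / 2) \<le> ((norm u)\<^sup>2) powr (a / 2) + ((norm v)\<^sup>2) powr (a / 2)"
    by (rule powr_add_le) (use assms in auto)
  finally show ?thesis unfolding sq by simp
qed

lemma one_plus_powr_le:
  fixes s r :: real
  assumes "0 \<le> s" "0 \<le> r"
  shows "(1 + s) powr r \<le> 2 powr r * (1 + s powr r)"
proof -
  have "(1 + s) powr r \<le> (2 * max 1 s) powr r"
    by (rule powr_mono2) (use assms in auto)
  also have "\<dots> = 2 powr r * (max 1 s) powr r" by (simp add: powr_mult)
  also have "(max 1 s) powr r \<le> 1 + s powr r" by (simp add: max_def)
  finally show ?thesis by simp
qed

section \<open>Lebesgue measure: bounded envelopes and moments of log-concave densities\<close>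

lemma nn_integral_lborel_affine:
  fixes f :: "'v::euclidean_space \<Rightarrow> ennreal"
  assumes [measurable]: "f \<in> borel_measurable borel" and c: "c \<noteq> 0"
  shows "(\<integral>\<^sup>+x. f x \<partial>lborel) = ennreal (\<bar>c\<bar> ^ DIM('v)) * (\<integral>\<^sup>+x. f (t + c *\<^sub>R x) \<partial>lborel)"
proof -
  let ?T = "\<lambda>x. t + c *\<^sub>R x"
  have "(\<integral>\<^sup>+x. f x \<partial>lborel) = (\<integral>\<^sup>+x. f x \<partial>density (distr lborel borel ?T) (\<lambda>_. ennreal (\<bar>c\<bar> ^ DIM('v))))"
    by (rule arg_cong[OF lborel_affine[OF c], where f="\<lambda>M. integral\<^sup>N M f"])
  also have "\<dots> = (\<integral>\<^sup>+x. ennreal (\<bar>c\<bar> ^ DIM('v)) * f x \<partial>distr lborel borel ?T)"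
    by (rule nn_integral_density) auto
  also have "\<dots> = (\<integral>\<^sup>+x. ennreal (\<bar>c\<bar> ^ DIM('v)) * f (?T x) \<partial>lborel)"
    by (rule nn_integral_distr) auto
  also have "\<dots> = ennreal (\<bar>c\<bar> ^ DIM('v)) * (\<integral>\<^sup>+x. f (?T x) \<partial>lborel)"
    by (rule nn_integral_cmult) simp
  finally show ?thesis .
qed

text \<open>If the value exceeded \<open>N\<close> on more than half of a ball, measured at \<open>y\<close> and at \<open>x - y\<close>,
  then both would be large simultaneously; for large \<open>N\<close> this is excluded by continuity of measure.\<close>
lemma quasi_submultiplicative_locally_bounded:
  fixes f :: "'v::euclidean_space \<Rightarrow> real"
  assumes [measurable]: "f \<in> borel_measurable borel" and pos: "\<And>x. 0 \<le> f x" and c: "0 < c" "0 < C"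
    and sub: "\<And>x y. f (x + y) \<le> C * (1 + f x) powr c * (1 + f y) powr c"
  shows "\<exists>B\<ge>0. \<forall>x. norm x \<le> R \<longrightarrow> f x \<le> B"
proof -
  define r where "r = max R 1"
  have r: "0 < r" "R \<le> r" unfolding r_def by auto
  \<comment> \<open>Radius \<open>2 * r\<close> keeps \<open>x - y\<close> inside the ball when
    \<open>norm x \<le> R\<close> and \<open>norm y \<le> r\<close>. The sets shrink to the empty
    set because \<open>f\<close> is finite everywhere.\<close>
  define A where "A = (\<lambda>N::nat. {x \<in> cball 0 (2 * r). real N < f x})"
  define v where "v = measure lborel (cball (0::'v) r)"
  have v: "v > 0" unfolding v_def using r by simp
  have A[measurable]: "A N \<in> sets lborel" for N unfolding A_def by measurable
  have "(\<lambda>N. measure lborel (A N)) \<longlonglongrightarrow> measure lborel (\<Inter>N. A N)"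
  proof (rule Lim_measure_decseq)
    show "range A \<subseteq> sets lborel" using A by auto
    show "decseq A" unfolding A_def decseq_def by fastforce
    show "emeasure lborel (A N) \<noteq> \<infinity>" for N
    proof -
      have "emeasure lborel (A N) \<le> emeasure lborel (cball (0::'v) (2 * r))"
        by (rule emeasure_mono) (auto simp: A_def)
      also have "\<dots> < \<infinity>" by (rule emeasure_lborel_cball_finite)
      finally show ?thesis by simp
    qed
  qed
  moreover have "(\<Inter>N. A N) = {}"
  proof -
    have "\<exists>N::nat. x \<notin> A N" for x
      using reals_Archimedean2[of "f x"] unfolding A_def by (auto simp: not_less intro: less_imp_le)
    then show ?thesis by blast
  qed
  ultimately have "(\<lambda>N. measure lborel (A N)) \<longlonglongrightarrow> 0" by simp
  then have "\<forall>\<^sub>F N in sequentially. measure lborel (A N) < v / 2"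
    using v by (intro order_tendstoD) auto
  then obtain N where N: "measure lborel (A N) < v / 2" by (auto simp: eventually_sequentially)
  have fin: "emeasure lborel (A N) < \<infinity>"
  proof -
    have "emeasure lborel (A N) \<le> emeasure lborel (cball (0::'v) (2 * r))"
      by (rule emeasure_mono) (auto simp: A_def)
    also have "\<dots> < \<infinity>" by (rule emeasure_lborel_cball_finite)
    finally show ?thesis .
  qed
  have bnd: "f x \<le> C * (1 + N) powr c * (1 + N) powr c" if x: "norm x \<le> R" for x
  proof -
    have "\<exists>y. f y \<le> N \<and> f (x - y) \<le> N"
    proof (rule ccontr)
      assume neg: "\<not> ?thesis"
      \<comment> \<open>Under the negation, a ball of volume \<open>v\<close> is covered by
        \<open>A N\<close> and its reflected copy, which have the same measure, below
        \<open>v / 2\<close>. As \<open>N\<close> was fixed before \<open>x\<close>, the resulting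
        bound is uniform.\<close>
      have cov: "cball 0 r \<subseteq> A N \<union> (\<lambda>y. x + (- 1) *\<^sub>R y) -` A N"
      proof
        fix y :: 'v assume y: "y \<in> cball 0 r"
        then have "norm (x - y) \<le> 2 * r" using norm_triangle_ineq4[of x y] x r by auto
        then show "y \<in> A N \<union> (\<lambda>y. x + (- 1) *\<^sub>R y) -` A N"
          using y neg r unfolding A_def by (auto simp: not_le)
      qed
      have m2[measurable]: "(\<lambda>y. x + (- 1) *\<^sub>R y) -` A N \<in> sets lborel"
        using measurable_sets[of "\<lambda>y. x + (- 1) *\<^sub>R y" borel borel "A N"] A[of N] by simp
      have "emeasure lborel (A N) = (\<integral>\<^sup>+y. indicator (A N) y \<partial>lborel)"
        by (rule nn_integral_indicator[OF A, symmetric])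
      also have "\<dots> = (\<integral>\<^sup>+y. indicator (A N) (x + (- 1) *\<^sub>R y) \<partial>lborel)"
        using A[of N] by (subst nn_integral_lborel_affine[of _ "-1" x]) auto
      also have "\<dots> = (\<integral>\<^sup>+y. indicator ((\<lambda>y. x + (- 1) *\<^sub>R y) -` A N) y \<partial>lborel)"
        by (intro nn_integral_cong) (auto simp: indicator_def)
      also have "\<dots> = emeasure lborel ((\<lambda>y. x + (- 1) *\<^sub>R y) -` A N)"
        by (rule nn_integral_indicator) (rule m2)
      finally have e2: "emeasure lborel ((\<lambda>y. x + (- 1) *\<^sub>R y) -` A N) = emeasure lborel (A N)" by simp
      have "emeasure lborel (cball (0::'v) r) \<le> emeasure lborel (A N \<union> (\<lambda>y. x + (- 1) *\<^sub>R y) -` A N)"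
        by (rule emeasure_mono[OF cov sets.Un[OF A m2]])
      also have "\<dots> \<le> emeasure lborel (A N) + emeasure lborel ((\<lambda>y. x + (- 1) *\<^sub>R y) -` A N)"
        by (rule emeasure_subadditive[OF A m2])
      also have "\<dots> = ennreal (2 * measure lborel (A N))"
        unfolding e2 using fin by (simp add: emeasure_eq_ennreal_measure flip: ennreal_plus)
      finally have "v \<le> 2 * measure lborel (A N)"
        unfolding v_def using emeasure_lborel_cball_finite[of "0::'v" r]
        by (simp add: emeasure_eq_ennreal_measure)
      with N show False by simp
    qed
    then obtain y where y: "f y \<le> N" "f (x - y) \<le> N" by blast
    have "f x \<le> C * (1 + f y) powr c * (1 + f (x - y)) powr c" using sub[of y "x - y"] by simp
    also have "\<dots> \<le> C * (1 + N) powr c * (1 + N) powr c"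
      using y c pos[of y] pos[of "x - y"] by (intro mult_mono powr_mono2) auto
    finally show ?thesis .
  qed
  show ?thesis
    by (intro exI[of _ "C * (1 + N) powr c * (1 + N) powr c"] conjI allI impI bnd) (use c in simp)
qed

text \<open>Log-concavity at the midpoint of 0 and \<open>x\<close>, with \<open>p\<close> small far
  out, gives \<open>p x \<le> \<eta> * p (x /\<^sub>R 2)\<close> beyond a radius \<open>R\<close>.
  Substituting \<open>2 *\<^sub>R y\<close> for \<open>x\<close> bounds the truncated moment
  \<open>I T\<close> by \<open>R\<^sup>2 + I T / 2\<close>; the last term is absorbed, and Fatou's
  lemma removes the truncation.\<close>

lemma log_concave_second_moment:
  fixes p :: "'v::euclidean_space \<Rightarrow> real"
  assumes [measurable]: "p \<in> borel_measurable borel" and pos: "\<And>x. 0 < p x"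
    and conc: "concave_on UNIV (\<lambda>x. ln (p x))" and lim: "(p \<longlongrightarrow> 0) at_infinity"
    and mass: "(\<integral>\<^sup>+x. ennreal (p x) \<partial>lborel) = 1"
  shows "(\<integral>\<^sup>+x. ennreal ((norm x)\<^sup>2 * p x) \<partial>lborel) < \<infinity>"
proof -
  \<comment> \<open>Chosen so that \<open>4 * 2 ^ DIM('v) * \<eta> = 1 / 2\<close>: the substitution
    produces the Jacobian \<open>2 ^ DIM('v)\<close>, and the squared norm the factor 4.\<close>
  define \<eta> :: real where "\<eta> = 1 / (8 * 2 ^ DIM('v))"
  have eta: "\<eta> > 0" unfolding \<eta>_def by simp
  have half: "p x * p 0 \<le> (p (x /\<^sub>R 2))\<^sup>2" for x
  proof -
    have "ln (p ((1 - 1/2) *\<^sub>R 0 + (1/2) *\<^sub>R x)) \<ge> (1 - 1/2) * ln (p 0) + (1/2) * ln (p x)"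
      by (rule concave_onD[OF conc]) auto
    moreover have "(1 - 1/2) *\<^sub>R 0 + (1/2) *\<^sub>R x = x /\<^sub>R 2" by (simp add: inverse_eq_divide)
    ultimately have "ln (p x) + ln (p 0) \<le> 2 * ln (p (x /\<^sub>R 2))" by simp
    moreover have "ln (p x * p 0) = ln (p x) + ln (p 0)"
      by (rule ln_mult_pos[OF pos pos])
    moreover have "ln ((p (x /\<^sub>R 2))\<^sup>2) = 2 * ln (p (x /\<^sub>R 2))"
      using ln_realpow[of "p (x /\<^sub>R 2)" 2] by simp
    ultimately have "ln (p x * p 0) \<le> ln ((p (x /\<^sub>R 2))\<^sup>2)" by simp
    moreover have "0 < p x * p 0" "0 < (p (x /\<^sub>R 2))\<^sup>2" by (intro mult_pos_pos zero_less_power pos)+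
    ultimately show ?thesis using ln_le_cancel_iff by blast
  qed
  have "\<forall>\<^sub>F y in at_infinity. p y < \<eta> * p 0"
    using eta pos[of 0] by (intro order_tendstoD(2)[OF lim]) auto
  then obtain b where b: "\<And>y. b \<le> norm y \<Longrightarrow> p y < \<eta> * p 0" unfolding eventually_at_infinity by blast
  define R where "R = 2 * max b 1"
  have decay: "p x \<le> \<eta> * p (x /\<^sub>R 2)" if "R \<le> norm x" for x
  proof -
    have "p (x /\<^sub>R 2) \<le> \<eta> * p 0" 
    proof (rule less_imp_le, rule b)
      show "b \<le> norm (x /\<^sub>R 2)" using that unfolding R_def by (simp add: max_def split: if_splits)
    qed
    then have "p (x /\<^sub>R 2) * p (x /\<^sub>R 2) \<le> \<eta> * p 0 * p (x /\<^sub>R 2)"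
      using pos[of "x /\<^sub>R 2"] by (intro mult_right_mono) auto
    then have "p x * p 0 \<le> (\<eta> * p (x /\<^sub>R 2)) * p 0"
      using half[of x] by (simp add: power2_eq_square mult.assoc mult.commute mult.left_commute)
    then show ?thesis using pos[of 0] by simp
  qed
  have [measurable]: "cball (0::'v) T \<in> sets borel" for T by simp
  define I where "I = (\<lambda>T. \<integral>\<^sup>+x. ennreal ((norm x)\<^sup>2 * p x * indicator (cball 0 T) x) \<partial>lborel)"
  have bound: "I T \<le> ennreal (2 * R\<^sup>2)" if T: "0 \<le> T" for T
  proof -
    \<comment> \<open>Finiteness of the truncated moment is what permits half of it to be subtracted
      at the end.\<close>
    have "I T \<le> (\<integral>\<^sup>+x. ennreal (T\<^sup>2) * ennreal (p x) \<partial>lborel)"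
      unfolding I_def
    proof (rule nn_integral_mono)
      fix x :: 'v
      have "(norm x)\<^sup>2 * p x * indicator (cball 0 T) x \<le> T\<^sup>2 * p x"
        using less_imp_le[OF pos[of x]] by (cases "x \<in> cball 0 T") (auto intro!: mult_right_mono power_mono)
      then show "ennreal ((norm x)\<^sup>2 * p x * indicator (cball 0 T) x) \<le> ennreal (T\<^sup>2) * ennreal (p x)"
        using pos[of x] by (simp add: ennreal_leI flip: ennreal_mult')
    qed
    also have "\<dots> = ennreal (T\<^sup>2)" using mass by (simp add: nn_integral_cmult)
    finally have fin: "I T < \<infinity>" by (simp add: le_less_trans)
    have m: "(\<lambda>x. ennreal ((norm x)\<^sup>2 * p (x /\<^sub>R 2) * indicator (cball 0 T) x)) \<in> borel_measurable lborel"
      by measurable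
    have "I T \<le> (\<integral>\<^sup>+x. ennreal (R\<^sup>2) * ennreal (p x)
        + ennreal \<eta> * ennreal ((norm x)\<^sup>2 * p (x /\<^sub>R 2) * indicator (cball 0 T) x) \<partial>lborel)"
      unfolding I_def
    proof (rule nn_integral_mono)
      fix x :: 'v
      have "(norm x)\<^sup>2 * p x * indicator (cball 0 T) x
        \<le> R\<^sup>2 * p x + \<eta> * ((norm x)\<^sup>2 * p (x /\<^sub>R 2) * indicator (cball 0 T) x)"
      proof (cases "R \<le> norm x")
        case True
        have "(norm x)\<^sup>2 * p x * indicator (cball 0 T) x \<le> (norm x)\<^sup>2 * (\<eta> * p (x /\<^sub>R 2)) * indicator (cball 0 T) x"
          using decay[OF True] by (intro mult_right_mono mult_left_mono) auto
        moreover have "0 \<le> R\<^sup>2 * p x" using pos[of x] by simp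
        ultimately show ?thesis by (simp add: algebra_simps)
      next
        case False
        then have "(norm x)\<^sup>2 * p x \<le> R\<^sup>2 * p x" using pos[of x]
          by (intro mult_right_mono power_mono) auto
        moreover have "(norm x)\<^sup>2 * p x * indicator (cball 0 T) x \<le> (norm x)\<^sup>2 * p x"
          using pos[of x] by (simp add: indicator_def)
        moreover have "0 \<le> \<eta> * ((norm x)\<^sup>2 * p (x /\<^sub>R 2) * indicator (cball 0 T) x)"
          using eta pos[of "x /\<^sub>R 2"] by simp
        ultimately show ?thesis by linarith
      qed
      then show "ennreal ((norm x)\<^sup>2 * p x * indicator (cball 0 T) x) \<le> ennreal (R\<^sup>2) * ennreal (p x)
        + ennreal \<eta> * ennreal ((norm x)\<^sup>2 * p (x /\<^sub>R 2) * indicator (cball 0 T) x)"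
        using eta pos[of x] pos[of "x /\<^sub>R 2"] by (simp add: ennreal_leI flip: ennreal_mult' ennreal_plus)
    qed
    also have "\<dots> = ennreal (R\<^sup>2)
        + ennreal \<eta> * (\<integral>\<^sup>+x. ennreal ((norm x)\<^sup>2 * p (x /\<^sub>R 2) * indicator (cball 0 T) x) \<partial>lborel)"
      by (subst nn_integral_add) (use m mass in \<open>simp_all add: nn_integral_cmult\<close>)
    also have "(\<integral>\<^sup>+x. ennreal ((norm x)\<^sup>2 * p (x /\<^sub>R 2) * indicator (cball 0 T) x) \<partial>lborel)
      = ennreal (2 ^ DIM('v)) * (\<integral>\<^sup>+y. ennreal ((norm (2 *\<^sub>R y))\<^sup>2 * p y * indicator (cball 0 T) (2 *\<^sub>R y)) \<partial>lborel)"
      by (subst nn_integral_lborel_affine[of _ 2 0]) auto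
    also have "(\<integral>\<^sup>+y. ennreal ((norm (2 *\<^sub>R y))\<^sup>2 * p y * indicator (cball 0 T) (2 *\<^sub>R y)) \<partial>lborel) \<le> ennreal 4 * I T"
    proof -
      have "(\<integral>\<^sup>+y. ennreal ((norm (2 *\<^sub>R y))\<^sup>2 * p y * indicator (cball 0 T) (2 *\<^sub>R y)) \<partial>lborel)
        \<le> (\<integral>\<^sup>+y. ennreal 4 * ennreal ((norm y)\<^sup>2 * p y * indicator (cball 0 T) y) \<partial>lborel)"
      proof (rule nn_integral_mono)
        fix y :: 'v
        have "norm y \<le> T" if "2 * norm y \<le> T" using that norm_ge_zero[of y] by linarith
        then have "(norm (2 *\<^sub>R y))\<^sup>2 * p y * indicator (cball 0 T) (2 *\<^sub>R y) \<le> 4 * ((norm y)\<^sup>2 * p y * indicator (cball 0 T) y)"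
          using pos[of y] by (auto simp: indicator_def power_mult_distrib)
        then show "ennreal ((norm (2 *\<^sub>R y))\<^sup>2 * p y * indicator (cball 0 T) (2 *\<^sub>R y))
          \<le> ennreal 4 * ennreal ((norm y)\<^sup>2 * p y * indicator (cball 0 T) y)"
          by (subst ennreal_mult'[symmetric]) (auto intro: ennreal_leI)
      qed
      also have "\<dots> = ennreal 4 * I T" unfolding I_def by (rule nn_integral_cmult) measurable
      finally show ?thesis .
    qed
    finally have "I T \<le> ennreal (R\<^sup>2) + ennreal \<eta> * (ennreal (2 ^ DIM('v)) * (ennreal 4 * I T))"
      by (simp add: mult_left_mono)
    moreover have "ennreal \<eta> * (ennreal (2 ^ DIM('v)) * (ennreal 4 * ennreal z)) = ennreal (z / 2)"
      if z: "0 \<le> z" for z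
    proof -
      have "ennreal (z / 2) = ennreal (\<eta> * (2 ^ DIM('v) * (4 * z)))" unfolding \<eta>_def by simp
      also have "\<dots> = ennreal \<eta> * ennreal (2 ^ DIM('v) * (4 * z))" using eta z by (intro ennreal_mult) auto
      also have "ennreal (2 ^ DIM('v) * (4 * z)) = ennreal (2 ^ DIM('v)) * ennreal (4 * z)"
        using z by (intro ennreal_mult) auto
      also have "ennreal (4 * z) = ennreal 4 * ennreal z" using z by (intro ennreal_mult) auto
      finally show ?thesis by simp
    qed
    moreover obtain z where z: "I T = ennreal z" "0 \<le> z" using fin by (cases "I T") auto
    ultimately have "ennreal z \<le> ennreal (R\<^sup>2 + z / 2)" by (simp add: z)
    then have "z \<le> R\<^sup>2 + z / 2" using z(2) by (subst (asm) ennreal_le_iff) auto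
    then have "z \<le> 2 * R\<^sup>2" by simp
    then show ?thesis by (simp add: z ennreal_leI)
  qed
  have "(\<integral>\<^sup>+x. ennreal ((norm x)\<^sup>2 * p x) \<partial>lborel)
      = (\<integral>\<^sup>+x. liminf (\<lambda>n. ennreal ((norm x)\<^sup>2 * p x * indicator (cball 0 (real n)) x)) \<partial>lborel)"
  proof (rule nn_integral_cong)
    fix x :: 'v
    obtain n0 :: nat where n0: "norm x \<le> n0" using real_arch_simple by blast
    have "(\<lambda>n. ennreal ((norm x)\<^sup>2 * p x * indicator (cball 0 (real n)) x)) \<longlonglongrightarrow> ennreal ((norm x)\<^sup>2 * p x)"
      by (rule tendsto_eventually) (use n0 in \<open>auto simp: eventually_sequentially indicator_def intro!: exI[of _ n0]\<close>)
    then show "ennreal ((norm x)\<^sup>2 * p x) = liminf (\<lambda>n. ennreal ((norm x)\<^sup>2 * p x * indicator (cball 0 (real n)) x))"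
      by (rule lim_imp_Liminf[OF sequentially_bot, symmetric])
  qed
  also have "\<dots> \<le> liminf (\<lambda>n. I (real n))"
    unfolding I_def by (rule nn_integral_liminf) measurable
  also have "\<dots> \<le> liminf (\<lambda>n. ennreal (2 * R\<^sup>2))"
    by (intro Liminf_mono always_eventually allI bound) simp
  also have "\<dots> < \<infinity>" by (simp add: Liminf_const)
  finally show ?thesis .
qed

section \<open>Log-concave densities\<close>

locale differentiable_log_concave =
  fixes p :: "'v::euclidean_space \<Rightarrow> real"
  assumes p_pos: "\<And>x. 0 < p x"
    and p_diff: "p differentiable_on UNIV"
    and p_conc: "concave_on UNIV (\<lambda>x. ln (p x))"
begin

text \<open>The gradient of the log-density \<open>ln p\<close>.\<close>

definition score :: "'v \<Rightarrow> 'v" where "score x = (1 / p x) *\<^sub>R gradient p x"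

text \<open>\<open>gradient\<close> is a definite description, so both existence and uniqueness are
  due: the derivative is represented by its adjoint at 1, and derivatives are unique.\<close>

lemma GDERIV_gradient: "GDERIV p x :> gradient p x"
proof -
  obtain p' where p': "(p has_derivative p') (at x)"
    using p_diff unfolding differentiable_on_def differentiable_def by auto
  have lin: "linear p'" using p' by (rule has_derivative_linear)
  have "p' = (\<lambda>h. h \<bullet> adjoint p' 1)" using adjoint_works[OF lin, of _ 1] by auto
  then have G: "GDERIV p x :> adjoint p' 1" using p' unfolding gderiv_def by simp
  show ?thesis unfolding gradient_def
  proof (rule theI[of _ "adjoint p' 1"])
    show "GDERIV p x :> adjoint p' 1" by (rule G)
    fix D assume "GDERIV p x :> D"
    then have "(\<lambda>h. h \<bullet> D) = (\<lambda>h. h \<bullet> adjoint p' 1)"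
      using G unfolding gderiv_def by (rule has_derivative_unique)
    then have "h \<bullet> D = h \<bullet> adjoint p' 1" for h by meson
    then show "D = adjoint p' 1" by (metis vector_eq_ldot)
  qed
qed

lemma p_continuous: "continuous_on A p"
  using differentiable_imp_continuous_on[OF p_diff] by (rule continuous_on_subset) simp

lemma p_measurable [measurable]: "p \<in> borel_measurable borel"
  by (rule borel_measurable_continuous_onI[OF p_continuous])

lemma DERIV_p_along: "((\<lambda>t. p (x + t *\<^sub>R v)) has_real_derivative (gradient p (x + t *\<^sub>R v) \<bullet> v)) (at t)"
proof -
  have "((\<lambda>t. x + t *\<^sub>R v) has_derivative (\<lambda>s. s *\<^sub>R v)) (at t)" by (auto intro!: derivative_eq_intros)
  from has_derivative_compose[OF this GDERIV_gradient[of "x + t *\<^sub>R v", unfolded gderiv_def]]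
  show ?thesis unfolding has_field_derivative_def
    by (rule has_derivative_eq_rhs) (auto simp: inner_commute)
qed

text \<open>Each coordinate is a pointwise limit of difference quotients of the continuous
  \<open>p\<close>.\<close>

lemma gradient_measurable [measurable]: "gradient p \<in> borel_measurable borel"
proof (subst borel_measurable_euclidean_space, intro ballI)
  fix i :: 'v assume "i \<in> Basis"
  show "(\<lambda>x. gradient p x \<bullet> i) \<in> borel_measurable borel"
  proof (rule borel_measurable_LIMSEQ_metric)
    fix x
    have "((\<lambda>t. p (x + t *\<^sub>R i)) has_real_derivative (gradient p x \<bullet> i)) (at 0)"
      using DERIV_p_along[of x i 0] by simp
    then have "(\<lambda>t. (p (x + t *\<^sub>R i) - p x) / t) \<midarrow>0\<rightarrow> gradient p x \<bullet> i"
      by (simp add: DERIV_def)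
    moreover have "filterlim (\<lambda>n. inverse (real (Suc n))) (at 0) sequentially"
      using LIMSEQ_inverse_real_of_nat by (auto simp: filterlim_at)
    ultimately show "(\<lambda>n. (p (x + inverse (real (Suc n)) *\<^sub>R i) - p x) / inverse (real (Suc n))) \<longlonglongrightarrow> gradient p x \<bullet> i"
      by (rule filterlim_compose)
  qed measurable
qed

lemma score_measurable [measurable]: "score \<in> borel_measurable borel"
  unfolding score_def by measurable

text \<open>On the segment from \<open>x\<close> to \<open>y\<close>, concavity puts every
  difference quotient at \<open>x\<close> above the slope of the full chord; their limit from the
  right is the directional derivative.\<close>

lemma ln_p_le_tangent: "ln (p y) \<le> ln (p x) + score x \<bullet> (y - x)"
proof -
  define g where "g = (\<lambda>t. ln (p (x + t *\<^sub>R (y - x))))"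
  have "(g has_real_derivative (score x \<bullet> (y - x))) (at 0)"
    unfolding g_def score_def
    using DERIV_p_along[of x "y - x" 0] p_pos[of x]
    by (auto intro!: derivative_eq_intros simp: divide_inverse)
  then have "(\<lambda>t. (g t - g 0) / t) \<midarrow>0\<rightarrow> score x \<bullet> (y - x)" by (simp add: DERIV_def)
  then have lim: "((\<lambda>t. (g t - g 0) / t) \<longlongrightarrow> score x \<bullet> (y - x)) (at_right 0)"
    by (rule filterlim_mono[OF _ order_refl at_within_le_at])
  have ev: "\<forall>\<^sub>F t in at_right 0. g 1 - g 0 \<le> (g t - g 0) / t"
    unfolding eventually_at_right_field
  proof (intro exI[of _ 1] conjI allI impI)
    fix t :: real assume t: "0 < t" "t < 1"
    have eq: "(1 - t) *\<^sub>R x + t *\<^sub>R y = x + t *\<^sub>R (y - x)" by (simp add: algebra_simps)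
    have "(1 - t) * ln (p x) + t * ln (p y) \<le> ln (p ((1 - t) *\<^sub>R x + t *\<^sub>R y))"
      using t by (intro concave_onD[OF p_conc]) auto
    then have "(1 - t) * g 0 + t * g 1 \<le> g t" unfolding eq g_def by simp
    then have "t * (g 1 - g 0) \<le> g t - g 0" by (simp add: algebra_simps)
    then show "g 1 - g 0 \<le> (g t - g 0) / t" using t by (simp add: pos_le_divide_eq mult.commute)
  qed simp
  have "g 1 - g 0 \<le> score x \<bullet> (y - x)"
    by (rule tendsto_lowerbound[OF lim ev]) simp
  then show ?thesis unfolding g_def by simp
qed

text \<open>Convexity of \<open>1 / p = exp (- ln p)\<close>: the vector
  \<open>(1 / p (x - t)) *\<^sub>R score (x - t)\<close> is the gradient of
  \<open>t \<mapsto> 1 / p (x - t)\<close>. The tangent of \<open>ln p\<close> is combined with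
  \<open>1 + w \<le> exp w\<close>.\<close>

lemma inverse_p_ge_tangent:
  "1 / p (x - t) - 1 / p (x - s) \<le> (1 / p (x - t)) * (score (x - t) \<bullet> (t - s))"
proof -
  define w where "w = ln (p (x - t)) - ln (p (x - s))"
  have "score (x - t) \<bullet> (s - t) \<le> w"
    using ln_p_le_tangent[of "x - s" "x - t"] unfolding w_def by (simp add: inner_diff_right)
  then have "1 + score (x - t) \<bullet> (s - t) \<le> exp w" using exp_ge_add_one_self[of w] by linarith
  moreover have "exp w = p (x - t) / p (x - s)" unfolding w_def using p_pos by (simp add: exp_diff)
  ultimately have "1 - p (x - t) / p (x - s) \<le> score (x - t) \<bullet> (t - s)" by (simp add: inner_diff_right)
  then have "(1 / p (x - t)) * (1 - p (x - t) / p (x - s)) \<le> (1 / p (x - t)) * (score (x - t) \<bullet> (t - s))"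
    using p_pos[of "x - t"] by (intro mult_left_mono) auto
  moreover have "(1 / p (x - t)) * (1 - p (x - t) / p (x - s)) = 1 / p (x - t) - 1 / p (x - s)"
    using p_pos[of "x - t"] by (simp add: field_simps)
  ultimately show ?thesis by simp
qed

text \<open>A step of length at most 1 against the score lowers \<open>ln p\<close> by at least
  \<open>norm (score x)\<close>, while \<open>ln p\<close> varies by at most \<open>2 * B\<close> on
  the ball of radius \<open>R + 1\<close>. The maximum with 0 covers negative \<open>R\<close>,
  where the ball may be empty and \<open>B\<close> of any sign.\<close>

lemma score_locally_bounded: "\<exists>B\<ge>0. \<forall>x. norm x \<le> R \<longrightarrow> norm (score x) \<le> B"
proof -
  have "continuous_on (cball 0 (R + 1)) (\<lambda>x. ln (p x))"
    by (intro continuous_on_ln p_continuous) (use p_pos in \<open>auto simp: less_imp_neq[symmetric]\<close>)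
  then have "bounded ((\<lambda>x. ln (p x)) ` cball 0 (R + 1))"
    by (intro compact_imp_bounded compact_continuous_image) auto
  then obtain B where "\<forall>y\<in>(\<lambda>x. ln (p x)) ` cball 0 (R + 1). norm y \<le> B" unfolding bounded_iff by blast
  then have B: "\<bar>ln (p x)\<bar> \<le> B" if "norm x \<le> R + 1" for x using that by auto
  have "norm (score x) \<le> max 0 (2 * B)" if x: "norm x \<le> R" for x
  proof -
    define u where "u = sgn (score x)"
    have u: "norm u \<le> 1" unfolding u_def by (simp add: norm_sgn)
    have su: "score x \<bullet> u = norm (score x)"
      unfolding u_def sgn_div_norm by (cases "score x = 0") (simp_all add: dot_square_norm power2_eq_square)
    have "norm (x - u) \<le> R + 1" using norm_triangle_ineq4[of x u] x u by linarith
    moreover have "norm x \<le> R + 1" using x by simp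
    moreover have "ln (p (x - u)) \<le> ln (p x) - norm (score x)"
      using ln_p_le_tangent[of "x - u" x] su by simp
    ultimately show ?thesis using B[of "x - u"] B[of x] by linarith
  qed
  then show ?thesis by (intro exI[of _ "max 0 (2 * B)"]) auto
qed

text \<open>The growth condition concerns large \<open>x\<close> only; the local bound fills in the
  remaining ball.\<close>

lemma score_growth:
  assumes "(\<lambda>x. norm (gradient p x) / p x) \<in> O[at_infinity](\<lambda>x. norm x powr b)"
  shows "\<exists>A\<ge>0. \<forall>x. norm (score x) \<le> A * (1 + norm x powr b)"
proof -
  have ns: "norm (gradient p x) / p x = norm (score x)" for x
    unfolding score_def using p_pos[of x] by simp
  obtain k where k: "k > 0" "\<forall>\<^sub>F x in at_infinity. norm (norm (gradient p x) / p x) \<le> k * norm (norm x powr b)"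
    using landau_o.bigE[OF assms] by blast
  then obtain R where R: "\<And>x. R \<le> norm x \<Longrightarrow> norm (score x) \<le> k * norm x powr b"
    unfolding eventually_at_infinity ns by auto
  obtain B where B: "B \<ge> 0" "\<And>x. norm x \<le> R \<Longrightarrow> norm (score x) \<le> B" using score_locally_bounded by blast
  have "norm (score x) \<le> (B + k) * (1 + norm x powr b)" for x
  proof -
    have "0 \<le> B * norm x powr b" "0 \<le> k * norm x powr b" using B k by auto
    moreover have "(B + k) * (1 + norm x powr b) = B + k + B * norm x powr b + k * norm x powr b"
      by (simp add: algebra_simps)
    moreover have "norm (score x) \<le> B \<or> norm (score x) \<le> k * norm x powr b"
      using R[of x] B(2)[of x] by linarith
    ultimately show ?thesis using B(1) k(1) by linarith
  qed
  then show ?thesis using B(1) k(1) by (intro exI[of _ "B + k"]) auto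
qed

text \<open>Midpoint convexity of \<open>ln p + \<delta> |x|\<^sup>a\<close> between \<open>x\<close> and \<open>x - 2 \<theta>\<close>.\<close>
lemma translation_ratio_le:
  fixes t x :: 'v
  assumes conv: "convex_on UNIV (\<lambda>x. ln (p x) + \<delta> * norm x powr a)"
    and a: "1 \<le> a" "a \<le> 2" and d: "0 < \<delta>"
  shows "(p (x - t))\<^sup>2 / (p x * p (x - 2 *\<^sub>R t)) \<le> exp (2 * \<delta> * norm t powr a)"
proof -
  have mid: "(1 - 1/2) *\<^sub>R x + (1/2) *\<^sub>R (x - 2 *\<^sub>R t) = x - t"
    by (simp add: algebra_simps flip: scaleR_add_left)
  have c: "ln (p (x - t)) + \<delta> * norm (x - t) powr a
    \<le> (1 - 1/2) * (ln (p x) + \<delta> * norm x powr a)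
      + (1/2) * (ln (p (x - 2 *\<^sub>R t)) + \<delta> * norm (x - 2 *\<^sub>R t) powr a)"
    using convex_onD[OF conv, of "1/2" x "x - 2 *\<^sub>R t"] unfolding mid by simp
  \<comment> \<open>The choice \<open>u = x - t\<close>, \<open>v = t\<close> makes the sum and the
    difference the two endpoints of the segment.\<close>
  have "norm x powr a + norm (x - 2 *\<^sub>R t) powr a \<le> 2 * (norm (x - t) powr a + norm t powr a)"
    using norm_powr_parallelogram[OF a, of "x - t" t] by (simp add: scaleR_2 algebra_simps)
  from mult_left_mono[OF this, of \<delta>] d
  have "\<delta> * norm x powr a + \<delta> * norm (x - 2 *\<^sub>R t) powr a \<le> 2 * (\<delta> * norm (x - t) powr a) + 2 * (\<delta> * norm t powr a)"
    by (simp add: algebra_simps)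
  with c have "2 * ln (p (x - t)) - (ln (p x) + ln (p (x - 2 *\<^sub>R t))) \<le> 2 * \<delta> * norm t powr a"
    by (simp add: field_simps)
  then have "exp (2 * ln (p (x - t)) - (ln (p x) + ln (p (x - 2 *\<^sub>R t)))) \<le> exp (2 * \<delta> * norm t powr a)" by simp
  then show ?thesis using p_pos by (simp add: exp_diff exp_add exp_double)
qed

end

section \<open>Importance sampling by translation\<close>

locale translation_sampling = differentiable_log_concave p
  for p :: "'v::euclidean_space \<Rightarrow> real" +
  fixes F Ft :: "'v \<Rightarrow> real" and a \<delta> c C :: real
  assumes p_mass: "(\<integral>\<^sup>+x. ennreal (p x) \<partial>lborel) = 1"
    and p_lim: "(p \<longlongrightarrow> 0) at_infinity"
    and a: "1 \<le> a" "a \<le> 2" and delta: "0 < \<delta>"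
    and growth: "(\<lambda>x. norm (gradient p x) / p x) \<in> O[at_infinity](\<lambda>x. norm x powr (a - 1))"
    and conv: "convex_on UNIV (\<lambda>x. ln (p x) + \<delta> * norm x powr a)"
    and F_measurable [measurable]: "F \<in> borel_measurable borel"
    and Ft_measurable [measurable]: "Ft \<in> borel_measurable borel"
    and Ft_nonneg: "\<And>x. 0 \<le> Ft x" and F_le: "\<And>x. \<bar>F x\<bar> \<le> Ft x"
    and c_pos: "0 < c" and C_pos: "0 < C"
    and Ft_sub: "\<And>x y. Ft (x + y) \<le> C * (1 + Ft x) powr c * (1 + Ft y) powr c"
    and moment: "integrable (density lborel p) (\<lambda>x. norm x powr (2 * (a - 1)) * Ft x powr (4 * c))"
    and V_finite: "\<And>t. (\<integral>\<^sup>+x. ennreal ((F x)\<^sup>2 * (p x / p (x - t))) \<partial>density lborel p) < \<infinity>"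
    and F_nonzero: "emeasure (density lborel p) {x. F x \<noteq> 0} > 0"
begin

definition \<mu> :: "'v measure" where "\<mu> = density lborel (\<lambda>x. ennreal (p x))"

text \<open>The real-valued form of \<open>V_trans\<close>; under \<open>V_finite\<close> the
  conversion by \<open>enn2real\<close> never meets infinity.\<close>

definition L :: "'v \<Rightarrow> real" where
  "L t = enn2real (\<integral>\<^sup>+x. ennreal ((F x)\<^sup>2 * (p x / p (x - t))) \<partial>\<mu>)"

text \<open>The normalizing factor of \<open>H_trans\<close>, which depends on \<open>t\<close>
  alone. Once it is removed, the mean of the rest is, after a change of variable, the integrated
  gradient of the integrand of \<open>L\<close>.\<close>

definition \<rho> :: "'v \<Rightarrow> real" where
  "\<rho> t = exp (- 2 * \<delta> * norm t powr a) / (1 + Ft (- t) powr (2 * c))"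

abbreviation H :: "'v \<Rightarrow> 'v \<Rightarrow> 'v" where "H \<equiv> H_trans p F Ft a \<delta> c"

lemma sets_mu [measurable_cong, simp]: "sets \<mu> = sets borel"
  unfolding \<mu>_def by simp

lemma space_mu [simp]: "space \<mu> = UNIV"
  unfolding \<mu>_def by simp

lemma prob_space_mu: "prob_space \<mu>"
  by (rule prob_spaceI) (simp add: \<mu>_def emeasure_density p_mass)

lemma H_eq:
  "H t x = (\<rho> t * ((F (x - t))\<^sup>2 * ((p (x - t))\<^sup>2 / (p x * p (x - 2 *\<^sub>R t))))) *\<^sub>R score (x - 2 *\<^sub>R t)"
  unfolding H_trans_def \<rho>_def score_def by (simp add: ac_simps)

lemma H_measurable: "(\<lambda>z. H (fst z) (snd z)) \<in> borel_measurable (borel \<Otimes>\<^sub>M borel)"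
  unfolding H_eq \<rho>_def by measurable

lemma Ft_bounded: "\<exists>B\<ge>0. \<forall>x. norm x \<le> R \<longrightarrow> Ft x \<le> B"
  by (rule quasi_submultiplicative_locally_bounded[OF Ft_measurable Ft_nonneg c_pos C_pos Ft_sub])

lemma rho_pos: "0 < \<rho> t"
  unfolding \<rho>_def by (intro divide_pos_pos add_pos_nonneg) auto

text \<open>Continuity of \<open>Ft\<close> is not assumed; its boundedness on balls, a consequence
  of quasi-submultiplicativity, controls the denominator of \<open>\<rho>\<close>.\<close>

lemma rho_lower: "\<exists>r>0. \<forall>t. norm t \<le> R \<longrightarrow> r \<le> \<rho> t"
proof -
  obtain B where B: "B \<ge> 0" "\<And>x. norm x \<le> R \<Longrightarrow> Ft x \<le> B" using Ft_bounded by blast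
  define r where "r = exp (- 2 * \<delta> * (max R 0) powr a) / (1 + B powr (2 * c))"
  have "r \<le> \<rho> t" if t: "norm t \<le> R" for t
  proof -
    have "norm t powr a \<le> (max R 0) powr a" using t a by (intro powr_mono2) auto
    then have 1: "exp (- 2 * \<delta> * (max R 0) powr a) \<le> exp (- 2 * \<delta> * norm t powr a)"
      using delta by simp
    have 2: "1 + Ft (- t) powr (2 * c) \<le> 1 + B powr (2 * c)"
      using B(2)[of "- t"] t Ft_nonneg c_pos by (intro add_left_mono powr_mono2) auto
    show ?thesis unfolding r_def \<rho>_def by (rule frac_le[OF _ 1 _ 2]) (auto intro: add_pos_nonneg)
  qed
  moreover have "0 < r" unfolding r_def by (intro divide_pos_pos add_pos_nonneg) auto
  ultimately show ?thesis by blast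
qed

section \<open>Quadratic growth of the second moment of \<open>H\<close>\<close>

definition W :: "'v \<Rightarrow> real" where
  "W x = (1 + Ft x powr (4 * c)) * (1 + norm x powr (2 * (a - 1)))"

lemma W_nonneg: "0 \<le> W x" unfolding W_def by (intro mult_nonneg_nonneg add_nonneg_nonneg) auto

lemma W_measurable [measurable]: "W \<in> borel_measurable borel"
  unfolding W_def by measurable

text \<open>\<open>W\<close> collects the dependence on \<open>x\<close> in the bound for the
  squared norm of \<open>H t x\<close>. Among its expanded terms, the product is integrable by
  hypothesis. The power of the norm is at most \<open>1 + (norm x)\<^sup>2\<close>, since
  \<open>2 * (a - 1) \<le> 2\<close>; the power of \<open>Ft\<close> is bounded on the unit ball and
  dominated by the product outside it.\<close>

lemma W_integrable: "integrable \<mu> W"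
proof -
  interpret mu: prob_space \<mu> by (rule prob_space_mu)
  obtain B where B: "B \<ge> 0" "\<And>x. norm x \<le> 1 \<Longrightarrow> Ft x \<le> B" using Ft_bounded by blast
  let ?m = "\<lambda>x. norm x powr (2 * (a - 1)) * Ft x powr (4 * c)"
  have m: "integrable \<mu> ?m" using moment unfolding \<mu>_def .
  have "(\<integral>\<^sup>+x. ennreal ((norm x)\<^sup>2) \<partial>\<mu>) = (\<integral>\<^sup>+x. ennreal ((norm x)\<^sup>2 * p x) \<partial>lborel)"
    unfolding \<mu>_def by (subst nn_integral_density)
      (auto intro!: nn_integral_cong simp: mult.commute p_pos less_imp_le ennreal_mult')
  also have "\<dots> < \<infinity>"
    by (rule log_concave_second_moment[OF p_measurable p_pos p_conc p_lim p_mass])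
  finally have n2: "integrable \<mu> (\<lambda>x. (norm x)\<^sup>2)" by (intro integrableI_bounded) auto
  show ?thesis
  proof (rule Bochner_Integration.integrable_bound)
    show "integrable \<mu> (\<lambda>x. 2 + (norm x)\<^sup>2 + B powr (4 * c) + 2 * ?m x)" using m n2 by simp
    show "AE x in \<mu>. norm (W x) \<le> norm (2 + (norm x)\<^sup>2 + B powr (4 * c) + 2 * ?m x)"
    proof (rule AE_I2)
      fix x :: 'v
      have b1: "norm x powr (2 * (a - 1)) \<le> 1 + (norm x)\<^sup>2"
      proof (cases "norm x \<le> 1")
        case True
        then have "norm x powr (2 * (a - 1)) \<le> 1 powr (2 * (a - 1))" using a by (intro powr_mono2) auto
        then show ?thesis by (simp add: add_increasing2)
      next
        case False
        then have "norm x powr (2 * (a - 1)) \<le> norm x powr 2" using a by (intro powr_mono) auto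
        then show ?thesis by (simp add: powr_numeral)
      qed
      have b2: "Ft x powr (4 * c) \<le> B powr (4 * c) + ?m x"
      proof (cases "norm x \<le> 1")
        case True
        then have "Ft x powr (4 * c) \<le> B powr (4 * c)"
          using B(2)[of x] Ft_nonneg c_pos by (intro powr_mono2) auto
        then show ?thesis by (simp add: add_increasing2)
      next
        case False
        then have "1 \<le> norm x powr (2 * (a - 1))" using a by (intro ge_one_powr_ge_zero) auto
        then have "1 * Ft x powr (4 * c) \<le> ?m x" by (intro mult_right_mono) auto
        then show ?thesis by (simp add: add_increasing)
      qed
      have "W x = 1 + norm x powr (2 * (a - 1)) + Ft x powr (4 * c) + ?m x"
        unfolding W_def by (simp add: algebra_simps)
      then have "W x \<le> 2 + (norm x)\<^sup>2 + B powr (4 * c) + 2 * ?m x" using b1 b2 by linarith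
      then show "norm (W x) \<le> norm (2 + (norm x)\<^sup>2 + B powr (4 * c) + 2 * ?m x)"
        using W_nonneg[of x] by simp
    qed
  qed measurable
qed

lemma damped_ratio_le:
  "exp (- 2 * \<delta> * norm t powr a) * ((p (x - t))\<^sup>2 / (p x * p (x - 2 *\<^sub>R t))) \<le> 1"
proof -
  have "exp (- 2 * \<delta> * norm t powr a) * ((p (x - t))\<^sup>2 / (p x * p (x - 2 *\<^sub>R t)))
      \<le> exp (- 2 * \<delta> * norm t powr a) * exp (2 * \<delta> * norm t powr a)"
    by (intro mult_left_mono translation_ratio_le[OF conv a delta]) simp
  then show ?thesis by (simp flip: exp_add)
qed

text \<open>The envelope inequality for \<open>x + (- t)\<close> separates the variables, and the
  denominator of \<open>H_trans\<close> is made to absorb the factor in \<open>- t\<close>, up to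
  \<open>2 powr (2 * c)\<close>.\<close>

lemma F_square_le:
  "(F (x - t))\<^sup>2 / (1 + Ft (- t) powr (2 * c)) \<le> C\<^sup>2 * 2 powr (2 * c) * (1 + Ft x) powr (2 * c)"
proof -
  have sq: "(s powr c)\<^sup>2 = s powr (2 * c)" if "0 < s" for s :: real
    using that by (simp add: powr_powr mult.commute flip: powr_numeral)
  have "\<bar>F (x - t)\<bar> \<le> C * (1 + Ft x) powr c * (1 + Ft (- t)) powr c"
    using F_le[of "x - t"] Ft_sub[of x "- t"] by simp
  then have "\<bar>F (x - t)\<bar>\<^sup>2 \<le> (C * (1 + Ft x) powr c * (1 + Ft (- t)) powr c)\<^sup>2"
    by (intro power_mono) auto
  then have "(F (x - t))\<^sup>2 \<le> C\<^sup>2 * (1 + Ft x) powr (2 * c) * (1 + Ft (- t)) powr (2 * c)"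
    using Ft_nonneg by (simp add: power_mult_distrib sq add_pos_nonneg)
  also have "\<dots> \<le> C\<^sup>2 * (1 + Ft x) powr (2 * c) * (2 powr (2 * c) * (1 + Ft (- t) powr (2 * c)))"
    using Ft_nonneg c_pos by (intro mult_left_mono one_plus_powr_le) auto
  finally have "(F (x - t))\<^sup>2 \<le> C\<^sup>2 * 2 powr (2 * c) * (1 + Ft x) powr (2 * c) * (1 + Ft (- t) powr (2 * c))"
    by (simp add: ac_simps)
  then show ?thesis by (subst pos_divide_le_eq) (auto intro: add_pos_nonneg)
qed

lemma translated_norm_powr_le:
  "1 + norm (x - 2 *\<^sub>R t) powr (a - 1) \<le> 4 * (1 + norm x powr (a - 1)) * (1 + norm t)"
proof -
  let ?b = "a - 1"
  have "norm (x - 2 *\<^sub>R t) powr ?b \<le> (norm x + 2 * norm t) powr ?b"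
    using norm_triangle_ineq4[of x "2 *\<^sub>R t"] a by (intro powr_mono2) auto
  also have "\<dots> \<le> norm x powr ?b + (2 * norm t) powr ?b" using a by (intro powr_add_le) auto
  \<comment> \<open>Adding 1 brings the base above 1, so that the exponent
    \<open>a - 1 \<le> 1\<close> can be raised to 1; the bound becomes linear in
    \<open>norm t\<close>.\<close>
  also have "(2 * norm t) powr ?b \<le> (1 + 2 * norm t) powr ?b" using a by (intro powr_mono2) auto
  also have "\<dots> \<le> (1 + 2 * norm t) powr 1" using a by (intro powr_mono) auto
  finally have "1 + norm (x - 2 *\<^sub>R t) powr ?b \<le> 2 + norm x powr ?b + 2 * norm t"
    by (simp add: add_pos_nonneg)
  moreover have "0 \<le> norm x powr ?b * norm t" "0 \<le> norm x powr ?b" by simp_all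
  moreover have "4 * (1 + norm x powr ?b) * (1 + norm t)
      = 4 + 4 * norm x powr ?b + 4 * norm t + 4 * (norm x powr ?b * norm t)"
    by (simp add: algebra_simps)
  ultimately show ?thesis using norm_ge_zero[of t] by linarith
qed

text \<open>Three separate bounds: the envelope quotient by a function of \<open>x\<close> alone,
  the damped likelihood ratio by 1, and the score by a factor linear in \<open>norm t\<close>.
  Squaring gives the quadratic growth that the recursion tolerates.\<close>

lemma H_norm_square_le: "\<exists>K\<ge>0. \<forall>t x. (norm (H t x))\<^sup>2 \<le> K * (1 + (norm t)\<^sup>2) * W x"
proof -
  obtain A where A: "A \<ge> 0" "\<And>x. norm (score x) \<le> A * (1 + norm x powr (a - 1))"
    using score_growth[OF growth] by blast
  define E where "E = C\<^sup>2 * 2 powr (2 * c)"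
  have E: "E \<ge> 0" unfolding E_def by simp
  \<comment> \<open>\<open>4 * A * E\<close> is the constant before squaring,
    \<open>2 powr (4 * c)\<close> comes from the envelope power, and the separate 4 from two uses of
    \<open>sq_add\<close>.\<close>
  define K where "K = (4 * A * E)\<^sup>2 * (4 * 2 powr (4 * c))"
  have sq_add: "(1 + y)\<^sup>2 \<le> 2 * (1 + y\<^sup>2)" for y :: real
    using sum_squares_bound[of 1 y] by (simp add: power2_sum)
  have sqp: "(s powr r)\<^sup>2 = s powr (2 * r)" if "0 \<le> s" for s r :: real
    using that by (cases "s = 0") (simp_all add: powr_powr mult.commute flip: powr_numeral)
  have "(norm (H t x))\<^sup>2 \<le> K * (1 + (norm t)\<^sup>2) * W x" for t x
  proof -
    let ?f = "(F (x - t))\<^sup>2 / (1 + Ft (- t) powr (2 * c))"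
    let ?e = "exp (- 2 * \<delta> * norm t powr a) * ((p (x - t))\<^sup>2 / (p x * p (x - 2 *\<^sub>R t)))"
    have e0: "0 \<le> ?e" using p_pos by (simp add: less_imp_le)
    have f0: "0 \<le> ?f" by (simp add: add_nonneg_nonneg)
    have "H t x = (?f * ?e) *\<^sub>R score (x - 2 *\<^sub>R t)"
      unfolding H_eq \<rho>_def by (simp add: ac_simps)
    then have "norm (H t x) = ?f * ?e * norm (score (x - 2 *\<^sub>R t))"
      using e0 f0 by (simp only: norm_scaleR abs_of_nonneg[OF mult_nonneg_nonneg[OF f0 e0]])
    also have "\<dots> \<le> ?f * 1 * norm (score (x - 2 *\<^sub>R t))"
      by (intro mult_right_mono mult_left_mono damped_ratio_le f0) simp
    also have "\<dots> \<le> (E * (1 + Ft x) powr (2 * c)) * norm (score (x - 2 *\<^sub>R t))"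
      unfolding E_def mult_1_right by (intro mult_right_mono F_square_le) simp
    also have "\<dots> \<le> (E * (1 + Ft x) powr (2 * c)) * (A * (4 * (1 + norm x powr (a - 1)) * (1 + norm t)))"
    proof (rule mult_left_mono)
      have "norm (score (x - 2 *\<^sub>R t)) \<le> A * (1 + norm (x - 2 *\<^sub>R t) powr (a - 1))" by (rule A(2))
      also have "\<dots> \<le> A * (4 * (1 + norm x powr (a - 1)) * (1 + norm t))"
        by (intro mult_left_mono translated_norm_powr_le A(1))
      finally show "norm (score (x - 2 *\<^sub>R t)) \<le> A * (4 * (1 + norm x powr (a - 1)) * (1 + norm t))" .
    qed (use E in simp)
    finally have "(norm (H t x))\<^sup>2
      \<le> ((E * (1 + Ft x) powr (2 * c)) * (A * (4 * (1 + norm x powr (a - 1)) * (1 + norm t))))\<^sup>2"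
      by (intro power_mono) auto
    also have "\<dots> = (4 * A * E)\<^sup>2 * (((1 + Ft x) powr (2 * c))\<^sup>2 * ((1 + norm x powr (a - 1))\<^sup>2 * (1 + norm t)\<^sup>2))"
      by (simp only: power_mult_distrib ac_simps)
    also have "\<dots> \<le> (4 * A * E)\<^sup>2 * ((2 powr (4 * c) * (1 + Ft x powr (4 * c)))
        * ((2 * (1 + norm x powr (2 * (a - 1)))) * (2 * (1 + (norm t)\<^sup>2))))"
    proof (intro mult_left_mono mult_mono)
      have "((1 + Ft x) powr (2 * c))\<^sup>2 = (1 + Ft x) powr (4 * c)" using Ft_nonneg[of x] by (simp add: sqp)
      also have "\<dots> \<le> 2 powr (4 * c) * (1 + Ft x powr (4 * c))"
        using Ft_nonneg c_pos by (intro one_plus_powr_le) auto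
      finally show "((1 + Ft x) powr (2 * c))\<^sup>2 \<le> 2 powr (4 * c) * (1 + Ft x powr (4 * c))" .
      show "(1 + norm x powr (a - 1))\<^sup>2 \<le> 2 * (1 + norm x powr (2 * (a - 1)))"
        using sq_add[of "norm x powr (a - 1)"] by (simp add: sqp)
      show "(1 + norm t)\<^sup>2 \<le> 2 * (1 + (norm t)\<^sup>2)" by (rule sq_add)
    qed (auto intro!: mult_nonneg_nonneg add_nonneg_nonneg)
    also have "\<dots> = K * (1 + (norm t)\<^sup>2) * W x" unfolding K_def W_def by (simp add: algebra_simps)
    finally show ?thesis .
  qed
  moreover have "0 \<le> K" unfolding K_def by simp
  ultimately show ?thesis by blast
qed

lemma H_second_moment:
  "\<exists>K. \<forall>t. integrable \<mu> (\<lambda>x. (norm (H t x))\<^sup>2)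
    \<and> (\<integral>x. (norm (H t x))\<^sup>2 \<partial>\<mu>) \<le> K * (1 + (norm t)\<^sup>2)"
proof -
  obtain K where K: "K \<ge> 0" "\<And>t x. (norm (H t x))\<^sup>2 \<le> K * (1 + (norm t)\<^sup>2) * W x"
    using H_norm_square_le by blast
  have [measurable]: "H t \<in> borel_measurable borel" for t unfolding H_eq by measurable
  have iW: "integrable \<mu> (\<lambda>x. K * (1 + (norm t)\<^sup>2) * W x)" for t using W_integrable by simp
  have i: "integrable \<mu> (\<lambda>x. (norm (H t x))\<^sup>2)" for t
  proof (rule Bochner_Integration.integrable_bound[OF iW[of t]])
    show "AE x in \<mu>. norm ((norm (H t x))\<^sup>2) \<le> norm (K * (1 + (norm t)\<^sup>2) * W x)"
      by (auto intro!: AE_I2 order_trans[OF K(2) abs_ge_self])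
  qed measurable
  have "(\<integral>x. (norm (H t x))\<^sup>2 \<partial>\<mu>) \<le> (K * (\<integral>x. W x \<partial>\<mu>)) * (1 + (norm t)\<^sup>2)" for t
  proof -
    have "(\<integral>x. (norm (H t x))\<^sup>2 \<partial>\<mu>) \<le> (\<integral>x. K * (1 + (norm t)\<^sup>2) * W x \<partial>\<mu>)"
      by (rule integral_mono[OF i iW K(2)])
    then show ?thesis by (simp add: ac_simps)
  qed
  with i show ?thesis by blast
qed

end

context translation_sampling
begin

section \<open>The mean field and the minimizers of \<open>L\<close>\<close>

lemma integrand_nonneg: "0 \<le> (F x)\<^sup>2 * (p x / p (x - t))"
  using p_pos[of x] p_pos[of "x - t"] by simp

lemma integrand_measurable [measurable]: "(\<lambda>x. (F x)\<^sup>2 * (p x / p (x - t))) \<in> borel_measurable borel"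
  by measurable

lemma integrand_integrable: "integrable \<mu> (\<lambda>x. (F x)\<^sup>2 * (p x / p (x - t)))"
  by (rule integrableI_nonneg[OF _ AE_I2[OF integrand_nonneg]])
    (use V_finite[of t] in \<open>simp_all add: \<mu>_def\<close>)

lemma L_nonneg: "0 \<le> L t"
  unfolding L_def by simp

lemma ennreal_L: "ennreal (L t) = (\<integral>\<^sup>+x. ennreal ((F x)\<^sup>2 * (p x / p (x - t))) \<partial>\<mu>)"
  using V_finite[of t] unfolding L_def \<mu>_def by (simp add: less_top)

lemma L_eq_integral: "L t = (\<integral>x. (F x)\<^sup>2 * (p x / p (x - t)) \<partial>\<mu>)"
  unfolding L_def by (rule integral_eq_nn_integral[symmetric, OF _ AE_I2[OF integrand_nonneg]]) simp

lemma H_measurable_2 [measurable]: "H t \<in> borel_measurable borel"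
  unfolding H_eq by measurable

lemma H_integrable: "integrable \<mu> (H t)"
proof -
  interpret mu: prob_space \<mu> by (rule prob_space_mu)
  have "integrable \<mu> (\<lambda>x. norm (H t x))"
    by (rule mu.square_integrable_imp_integrable) (use H_second_moment in auto)
  then show ?thesis by (simp add: integrable_norm_iff)
qed

text \<open>Translating by \<open>t\<close> turns the mean of \<open>H t\<close> into \<open>\<rho> t\<close> times the gradient of the
  integrand of \<open>L\<close>, to which the tangent inequality for the convex function \<open>t \<mapsto> 1 / p (x - t)\<close>
  applies pointwise.\<close>
lemma drift: "\<rho> t * (L t - L s) \<le> (\<integral>x. H t x \<partial>\<mu>) \<bullet> (t - s)"
proof -
  \<comment> \<open>The density times the gradient in \<open>t\<close> of the integrand of
    \<open>L\<close>, paired with \<open>t - s\<close>.\<close>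
  define \<Psi> where "\<Psi> = (\<lambda>y. p y * ((F y)\<^sup>2 * (p y / p (y - t)) * (score (y - t) \<bullet> (t - s))))"
  have [measurable]: "\<Psi> \<in> borel_measurable borel" unfolding \<Psi>_def by measurable
  have i_shift: "integrable lborel (\<lambda>x. \<Psi> (- t + x)) \<longleftrightarrow> integrable lborel \<Psi>"
    using integrable_distr_eq[of "(+) (- t)" lborel borel \<Psi>] unfolding lborel_distr_plus by simp
  have int_shift: "(\<integral>x. \<Psi> x \<partial>lborel) = (\<integral>x. \<Psi> (- t + x) \<partial>lborel)"
    using integral_distr[of "(+) (- t)" lborel borel \<Psi>] unfolding lborel_distr_plus by simp
  \<comment> \<open>The density cancels \<open>p x\<close> in the denominator of
    \<open>H_trans\<close>, and what is left besides \<open>\<rho> t\<close> is a function of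
    \<open>x - t\<close>; this explains the argument \<open>x - 2 *\<^sub>R t\<close> there.\<close>
  have pt: "p x * (H t x \<bullet> (t - s)) = \<rho> t * \<Psi> (- t + x)" for x
  proof -
    have "- t + x - t = x - 2 *\<^sub>R t" "- t + x = x - t" by (simp_all add: scaleR_2)
    then show ?thesis unfolding H_eq \<Psi>_def using p_pos[of x]
      by (simp only: inner_scaleR_left) (simp add: power2_eq_square)
  qed
  have iH: "integrable \<mu> (\<lambda>x. H t x \<bullet> (t - s))" using H_integrable by simp
  have iL: "integrable lborel (\<lambda>x. \<rho> t * \<Psi> (- t + x))"
    using iH unfolding \<mu>_def by (subst (asm) integrable_density) (auto simp: p_pos less_imp_le pt)
  \<comment> \<open>Integrability of \<open>\<Psi>\<close> is inherited from \<open>H t\<close>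
    through the translation, after division by \<open>\<rho> t > 0\<close>.\<close>
  then have i\<Psi>: "integrable lborel \<Psi>"
    using rho_pos[of t] unfolding i_shift[symmetric] by simp
  have id: "integrable lborel (\<lambda>x. p x * ((F x)\<^sup>2 * (p x / p (x - u))))"
    and Ld: "L u = (\<integral>x. p x * ((F x)\<^sup>2 * (p x / p (x - u))) \<partial>lborel)" for u
  proof -
    show "integrable lborel (\<lambda>x. p x * ((F x)\<^sup>2 * (p x / p (x - u))))"
      using integrand_integrable[of u] unfolding \<mu>_def
      by (subst (asm) integrable_density) (auto simp: p_pos less_imp_le)
    show "L u = (\<integral>x. p x * ((F x)\<^sup>2 * (p x / p (x - u))) \<partial>lborel)"
      unfolding L_eq_integral \<mu>_def by (subst integral_density) (auto simp: p_pos less_imp_le)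
  qed
  have "L t - L s = (\<integral>x. p x * ((F x)\<^sup>2 * (p x / p (x - t))) - p x * ((F x)\<^sup>2 * (p x / p (x - s))) \<partial>lborel)"
    unfolding Ld using id by simp
  also have "\<dots> \<le> (\<integral>x. \<Psi> x \<partial>lborel)"
  proof (rule integral_mono)
    fix x
    have "p x * ((F x)\<^sup>2 * p x) * (1 / p (x - t) - 1 / p (x - s))
      \<le> p x * ((F x)\<^sup>2 * p x) * ((1 / p (x - t)) * (score (x - t) \<bullet> (t - s)))"
      using p_pos[of x] by (intro mult_left_mono inverse_p_ge_tangent) simp
    then show "p x * ((F x)\<^sup>2 * (p x / p (x - t))) - p x * ((F x)\<^sup>2 * (p x / p (x - s))) \<le> \<Psi> x"
      unfolding \<Psi>_def by (simp add: algebra_simps)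
  qed (use id i\<Psi> in auto)
  also have "\<dots> = (\<integral>x. \<Psi> (- t + x) \<partial>lborel)"
    by (rule int_shift)
  finally have "\<rho> t * (L t - L s) \<le> \<rho> t * (\<integral>x. \<Psi> (- t + x) \<partial>lborel)"
    using rho_pos[of t] by (intro mult_left_mono) auto
  also have "\<dots> = (\<integral>x. p x * (H t x \<bullet> (t - s)) \<partial>lborel)" unfolding pt by simp
  also have "\<dots> = (\<integral>x. H t x \<bullet> (t - s) \<partial>\<mu>)"
    unfolding \<mu>_def by (subst integral_density) (auto simp: p_pos less_imp_le)
  also have "\<dots> = (\<integral>x. H t x \<partial>\<mu>) \<bullet> (t - s)"
    by (rule integral_inner_left) (rule H_integrable)
  finally show ?thesis .
qed

text \<open>Fatou's lemma, the nonnegative integrand being continuous in \<open>t\<close>.\<close>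

lemma L_lower_semicontinuous:
  assumes u: "u \<longlonglongrightarrow> t" and l: "(\<lambda>n. L (u n)) \<longlonglongrightarrow> l"
  shows "L t \<le> l"
proof -
  have l0: "0 \<le> l" by (rule LIMSEQ_le_const[OF l]) (auto simp: L_nonneg)
  have "ennreal (L t) = (\<integral>\<^sup>+x. liminf (\<lambda>n. ennreal ((F x)\<^sup>2 * (p x / p (x - u n)))) \<partial>\<mu>)"
    unfolding ennreal_L
  proof (rule nn_integral_cong)
    fix x
    have "isCont p (x - t)"
      using p_continuous[of UNIV] by (simp add: continuous_on_eq_continuous_at)
    then have "(\<lambda>n. p (x - u n)) \<longlonglongrightarrow> p (x - t)"
      by (rule isCont_tendsto_compose) (intro tendsto_intros u)
    then have "(\<lambda>n. ennreal ((F x)\<^sup>2 * (p x / p (x - u n)))) \<longlonglongrightarrow> ennreal ((F x)\<^sup>2 * (p x / p (x - t)))"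
      using p_pos[of "x - t"] by (intro tendsto_ennrealI tendsto_intros) auto
    then show "ennreal ((F x)\<^sup>2 * (p x / p (x - t))) = liminf (\<lambda>n. ennreal ((F x)\<^sup>2 * (p x / p (x - u n))))"
      by (rule lim_imp_Liminf[OF sequentially_bot, symmetric])
  qed
  also have "\<dots> \<le> liminf (\<lambda>n. ennreal (L (u n)))"
    unfolding ennreal_L by (rule nn_integral_liminf) measurable
  also have "\<dots> = ennreal l"
    by (rule lim_imp_Liminf[OF sequentially_bot]) (intro tendsto_ennrealI l)
  finally show ?thesis using l0 by simp
qed

text \<open>Far translations send \<open>p (x - t)\<close> to 0, hence the integrand to infinity
  wherever \<open>F\<close> is nonzero, an event of positive probability. Fatou's lemma then
  excludes bounded values along such a sequence.\<close>

lemma L_coercive: "\<exists>R. \<forall>t. L t \<le> m \<longrightarrow> norm t \<le> R"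
proof (rule ccontr)
  assume "\<not> ?thesis"
  then have "\<forall>n::nat. \<exists>t. L t \<le> m \<and> real n < norm t" by (auto simp: not_le)
  then obtain u where u: "\<And>n. L (u n) \<le> m" "\<And>n. real n < norm (u n)" by metis
  have dens: "(\<lambda>n. p (x - u n)) \<longlonglongrightarrow> 0" for x
  proof (rule filterlim_compose[OF p_lim], rule filterlim_norm_at_top_imp_at_infinity)
    have "filterlim (\<lambda>n. - norm x + real n) at_top sequentially"
      by (rule filterlim_tendsto_add_at_top[OF tendsto_const filterlim_real_sequentially])
    moreover have "- norm x + real n \<le> norm (x - u n)" for n
      using norm_triangle_ineq2[of "u n" x] u(2)[of n] by (simp add: norm_minus_commute)
    ultimately show "filterlim (\<lambda>n. norm (x - u n)) at_top sequentially"
      by (rule filterlim_at_top_mono[OF _ always_eventually[OF allI]])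
  qed
  have top: "liminf (\<lambda>n. ennreal ((F x)\<^sup>2 * (p x / p (x - u n)))) = \<infinity>" if "F x \<noteq> 0" for x
  proof -
    have "filterlim (\<lambda>n. inverse (p (x - u n))) at_top sequentially"
      by (rule filterlim_inverse_at_top[OF dens]) (simp add: p_pos)
    then have "filterlim (\<lambda>n. ((F x)\<^sup>2 * p x) * inverse (p (x - u n))) at_top sequentially"
      using that p_pos[of x] by (intro filterlim_tendsto_pos_mult_at_top[OF tendsto_const]) auto
    then have "(\<lambda>n. ennreal ((F x)\<^sup>2 * (p x / p (x - u n)))) \<longlonglongrightarrow> \<infinity>"
      by (simp add: ennreal_tendsto_top_eq_at_top divide_inverse mult.assoc)
    then show ?thesis by (rule lim_imp_Liminf[OF sequentially_bot])
  qed
  have "(\<infinity>::ennreal) = (\<integral>\<^sup>+x. \<infinity> * indicator {x. F x \<noteq> 0} x \<partial>\<mu>)"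
    using F_nonzero unfolding \<mu>_def[symmetric] by (subst nn_integral_cmult_indicator) (auto simp: ennreal_top_mult)
  also have "\<dots> \<le> (\<integral>\<^sup>+x. liminf (\<lambda>n. ennreal ((F x)\<^sup>2 * (p x / p (x - u n)))) \<partial>\<mu>)"
  proof (rule nn_integral_mono)
    show "\<infinity> * indicator {x. F x \<noteq> 0} x \<le> liminf (\<lambda>n. ennreal ((F x)\<^sup>2 * (p x / p (x - u n))))" for x
    proof (cases "F x = 0")
      case False then show ?thesis unfolding top[OF False] by simp
    qed simp
  qed
  also have "\<dots> \<le> liminf (\<lambda>n. ennreal (L (u n)))"
    unfolding ennreal_L by (rule nn_integral_liminf) measurable
  also have "\<dots> \<le> liminf (\<lambda>n. ennreal m)"
    by (intro Liminf_mono always_eventually allI ennreal_leI u)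
  also have "\<dots> < \<infinity>" by (simp add: Liminf_const)
  finally show False by simp
qed

text \<open>The direct method: coercivity traps a minimizing sequence in a ball, and lower
  semicontinuity evaluates \<open>L\<close> at a cluster point.\<close>

lemma Argmin_L_nonempty: "Argmin L \<noteq> {}"
proof -
  define m where "m = Inf (range L)"
  have bdd: "bdd_below (range L)" by (rule bdd_belowI2[of _ 0]) (rule L_nonneg)
  have m: "m \<le> L t" for t unfolding m_def by (rule cInf_lower[OF _ bdd]) simp
  have "\<exists>t. L t < m + 1 / Suc n" for n
    using cInf_lessD[of "range L" "m + 1 / Suc n"] unfolding m_def by auto
  then obtain u where u: "\<And>n. L (u n) < m + 1 / Suc n" by metis
  obtain R where R: "\<And>t. L t \<le> m + 1 \<Longrightarrow> norm t \<le> R" using L_coercive by blast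
  have "L (u n) \<le> m + 1" for n
  proof -
    have "1 / real (Suc n) \<le> 1" by simp
    then show ?thesis using u[of n] by linarith
  qed
  then have "\<forall>n. u n \<in> cball 0 R" using R by auto
  then obtain t \<sigma> where \<sigma>: "strict_mono \<sigma>" and t: "(u \<circ> \<sigma>) \<longlonglongrightarrow> t"
    using seq_compactE[OF compact_cball[of 0 R, unfolded compact_eq_seq_compact_metric], of u] by metis
  have "(\<lambda>n. m + 1 / Suc n) \<longlonglongrightarrow> m + 0"
    by (intro tendsto_add tendsto_const) (use LIMSEQ_inverse_real_of_nat in \<open>simp add: inverse_eq_divide\<close>)
  then have "(\<lambda>n. m + 1 / Suc n) \<longlonglongrightarrow> m" by simp
  then have "(\<lambda>n. L (u n)) \<longlonglongrightarrow> m"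
    by (rule tendsto_sandwich[rotated 3, where f="\<lambda>_. m"])
      (intro always_eventually allI m less_imp_le[OF u] tendsto_const)+
  from LIMSEQ_subseq_LIMSEQ[OF this \<sigma>] have "(\<lambda>j. L ((u \<circ> \<sigma>) j)) \<longlonglongrightarrow> m" by (simp add: o_def)
  from L_lower_semicontinuous[OF t this] have "t \<in> Argmin L"
    using order_trans[OF _ m] unfolding Argmin_def by blast
  then show ?thesis by blast
qed

end

section \<open>Transfer from the law of \<open>X\<close> to the random recursion\<close>

theorem theorem2:
  fixes M :: "'w measure"
    and X :: "'w \<Rightarrow> real ^ 'd"
    and p F Ft :: "real ^ 'd \<Rightarrow> real"
    and a \<delta> c C :: real
    and \<gamma> :: "nat \<Rightarrow> real"
    and Xs \<theta> :: "nat \<Rightarrow> 'w \<Rightarrow> real ^ 'd"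
    and \<theta>\<^sub>0 :: "real ^ 'd"
  assumes "prob_space M"
    and "distributed M lborel X (\<lambda>x. ennreal (p x))"
    and "\<forall>x. p x > 0"
    and "F \<in> borel_measurable borel"
    and "integrable M (\<lambda>\<omega>. (F (X \<omega>))\<^sup>2)"
    and "measure M {\<omega> \<in> space M. F (X \<omega>) \<noteq> 0} > 0"
    and "p differentiable_on UNIV"
    and "concave_on UNIV (\<lambda>x. ln (p x))"
    and "(p \<longlongrightarrow> 0) at_infinity"
    and "a \<in> {1..2}" and "\<delta> > 0"
    and "(\<lambda>x. norm (gradient p x) / p x) \<in> O[at_infinity](\<lambda>x. norm x powr (a - 1))"
    and "convex_on UNIV (\<lambda>x. ln (p x) + \<delta> * norm x powr a)"
    and "\<forall>\<eta>. V_trans M X p F \<eta> < \<infinity>"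
    and "\<forall>K>0. integrable M (\<lambda>\<omega>. (F (X \<omega>))\<^sup>2 * exp (K * norm (X \<omega>) powr (a - 1)))"
    and "c > 0" and "C > 0"
    and "Ft \<in> borel_measurable borel" and "\<forall>x. Ft x \<ge> 0"
    and "\<forall>x. \<bar>F x\<bar> \<le> Ft x"
    and "\<forall>x y. Ft (x + y) \<le> C * (1 + Ft x) powr c * (1 + Ft y) powr c"
    and "integrable M (\<lambda>\<omega>. norm (X \<omega>) powr (2 * (a - 1)) * Ft (X \<omega>) powr (4 * c))"
    and "\<forall>n\<ge>1. \<gamma> n > 0"
    and "filterlim (\<lambda>N. \<Sum>n=1..N. \<gamma> n) at_top sequentially"
    and "summable (\<lambda>n. (\<gamma> (Suc n))\<^sup>2)"
    and "prob_space.indep_vars M (\<lambda>_. borel) Xs {1..}"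
    and "\<forall>n\<ge>1. distr M borel (Xs n) = distr M borel X"
    and "\<forall>\<omega>\<in>space M. \<theta> 0 \<omega> = \<theta>\<^sub>0"
    and "\<forall>n. \<forall>\<omega>\<in>space M.
           \<theta> (n + 1) \<omega> = \<theta> n \<omega> - \<gamma> (n + 1) *\<^sub>R H_trans p F Ft a \<delta> c (\<theta> n \<omega>) (Xs (n + 1) \<omega>)"
  shows "\<exists>\<theta>star. \<theta>star \<in> borel_measurable M
           \<and> (\<forall>\<omega>\<in>space M. \<theta>star \<omega> \<in> Argmin (V_trans M X p F))
           \<and> integrable M (\<lambda>\<omega>. (norm (\<theta>star \<omega>))\<^sup>2)
           \<and> (AE \<omega> in M. (\<lambda>n. \<theta> n \<omega>) \<longlonglongrightarrow> \<theta>star \<omega>)"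
proof -
  interpret M: prob_space M by fact
  interpret lc: differentiable_log_concave p by unfold_locales (use assms in auto)
  note [measurable] = \<open>F \<in> borel_measurable borel\<close> \<open>Ft \<in> borel_measurable borel\<close>
  have [measurable]: "X \<in> borel_measurable M"
    using distributed_measurable[OF assms(2)] by simp
  have dX: "distr M borel X = density lborel (\<lambda>x. ennreal (p x))"
    using distributed_distr_eq_density[OF assms(2)] by (metis distr_cong sets_lborel)
  have mass: "(\<integral>\<^sup>+x. ennreal (p x) \<partial>lborel) = 1"
  proof -
    interpret D: prob_space "density lborel (\<lambda>x. ennreal (p x))"
      unfolding dX[symmetric] by (rule M.prob_space_distr) simp
    show ?thesis using D.emeasure_space_1 by (simp add: emeasure_density)
  qed
  have V: "V_trans M X p F t = (\<integral>\<^sup>+x. ennreal ((F x)\<^sup>2 * (p x / p (x - t))) \<partial>density lborel p)" for t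
    unfolding V_trans_def dX[symmetric] by (subst nn_integral_distr) auto
  have moment: "integrable (density lborel p) (\<lambda>x. norm x powr (2 * (a - 1)) * Ft x powr (4 * c))"
    using assms(22) unfolding dX[symmetric] by (subst integrable_distr_eq) auto
  have nonzero: "emeasure (density lborel p) {x. F x \<noteq> 0} > 0"
  proof -
    have "emeasure (distr M borel X) {x. F x \<noteq> 0} = emeasure M {\<omega> \<in> space M. F (X \<omega>) \<noteq> 0}"
      by (subst emeasure_distr) (auto intro!: arg_cong[where f="emeasure M"])
    then show ?thesis using assms(6) unfolding dX[symmetric] by (simp add: M.emeasure_eq_measure)
  qed
  interpret T: translation_sampling p F Ft a \<delta> c C
  proof unfold_locales
    show "(\<integral>\<^sup>+x. ennreal ((F x)\<^sup>2 * (p x / p (x - t))) \<partial>density lborel p) < \<infinity>" for t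
      using assms(14) unfolding V by blast
  qed (use assms mass moment nonzero in auto)
  obtain K where K: "\<And>t. integrable T.\<mu> (\<lambda>x. (norm (T.H t x))\<^sup>2)"
    "\<And>t. (\<integral>x. (norm (T.H t x))\<^sup>2 \<partial>T.\<mu>) \<le> K * (1 + (norm t)\<^sup>2)"
    using T.H_second_moment by blast
  \<comment> \<open>Shifting the index by one turns the sums from 1 to \<open>N\<close> into initial
    partial sums of a series, which cannot both converge and tend to infinity.\<close>
  have gdiv: "\<not> summable (\<lambda>n. \<gamma> (Suc n))"
  proof
    assume "summable (\<lambda>n. \<gamma> (Suc n))"
    then have "(\<lambda>N. \<Sum>n<N. \<gamma> (Suc n)) \<longlonglongrightarrow> (\<Sum>n. \<gamma> (Suc n))" by (rule summable_LIMSEQ)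
    moreover have "(\<Sum>n<N. \<gamma> (Suc n)) = (\<Sum>n=1..N. \<gamma> n)" for N
      by (rule sum.reindex_bij_witness[of _ "\<lambda>n. n - 1" Suc]) auto
    ultimately show False
      using assms(24) not_tendsto_and_filterlim_at_infinity[OF sequentially_bot, of "\<lambda>N. \<Sum>n=1..N. \<gamma> n"]
      by (auto intro: filterlim_at_top_imp_at_infinity)
  qed
  interpret S: stochastic_approximation M borel T.\<mu> T.H \<gamma> Xs \<theta> \<theta>\<^sub>0 K
  proof unfold_locales
    show "distr M borel (Xs n) = T.\<mu>" if "1 \<le> n" for n
      using assms(27) that unfolding T.\<mu>_def dX[symmetric] by blast
  qed (use assms K T.H_measurable in auto)
  interpret A: lyapunov_stochastic_approximation M borel T.\<mu> T.H \<gamma> Xs \<theta> \<theta>\<^sub>0 K T.L T.\<rho>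
    by unfold_locales
      (use T.drift T.L_lower_semicontinuous T.rho_lower T.Argmin_L_nonempty gdiv in \<open>auto simp: S.h_def\<close>)
  \<comment> \<open>All values are finite and nonnegative, so comparison in \<open>ennreal\<close>
    and in the reals selects the same minimizers.\<close>
  have "V_trans M X p F = (\<lambda>t. ennreal (T.L t))"
    unfolding V T.ennreal_L T.\<mu>_def by simp
  then have "Argmin (V_trans M X p F) = Argmin T.L"
    unfolding Argmin_def by (simp add: T.L_nonneg)
  then show ?thesis using A.AE_converges_to_Argmin by simp
qed

end
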